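(* Let $\{(\mathbf w_t,\mathbf D_t,\boldsymbol\mu_t,\mathbf z_t)\}_{t\ge1}$ be generated by the saddle-point dynamics with Laplacian averaging (defined in the context) over a sequence $\{\mathcal G_t\}_{t\ge1}$ of $B$-jointly connected, $\delta$-nondegenerate, weight-balanced digraphs on $\{1,\dots,N\}$ satisfying $\sup_{t\ge1}\sigma_{\max}(\mathsf L_t)\le\overline\Lambda$. Let $d_{\max}:=\max\{d_{\mathrm{out},t}(k): k\in\{1,\dots,N\},\,t\in\mathbb Z_{\ge1}\}$, let $\tilde\delta'\in(0,1)$, $\tilde\delta:=\min\{\tilde\delta',(1-\tilde\delta')\tfrac{\delta}{d_{\max}}\}$, and let the consensus stepsize satisfy $\sigma\in\big[\tfrac{\tilde\delta}{\delta},\tfrac{1-\tilde\delta}{d_{\max}}\big]$. Assume that $$\|\mathbf w_t\|_2\le B_{\mathbf w},\quad \|\mathbf D_t\|_2\le B_{\mathbf D},\quad \|\boldsymbol\mu_t\|_2\le B_{\boldsymbol\mu},\quad \|\mathbf z_t\|_2\le B_{\mathbf z}$$ for all $t\in\mathbb Z_{\ge1}$ whenever the sequence of learning rates $\{\eta_t\}_{t\ge1}\subset\mathbb R_{>0}$ is uniformly bounded. Similarly, assume $$\|g_{\mathbf w_t}\|_2\le H_{\mathbf w},\quad \|g_{\mathbf D_t}\|_2\le H_{\mathbf D},\quad \|g_{\boldsymbol\mu_t}\|_2\le H_{\boldsymbol\mu},\quad \|g_{\mathbf z_t}\|_2\le H_{\mathbf z}$$ for all $t\in\mathbb Z_{\ge1}$.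 Let the learning rates be chosen by the Doubling Trick: for each $m=0,1,2,\dots$, $\eta_s=1/\sqrt{2^m}$ for $s=2^m,\dots,2^{m+1}-1$. Then, for any saddle point $(\mathbf w^*,\mathbf D^*,\boldsymbol\mu^*,\mathbf z^* )$ of $\phi$ on $S$ with $\mathbf D^*=(D^*,\dots,D^* )$ and $\mathbf z^*=(z^*,\dots,z^* )$ for some $(D^*,z^* )\in\mathcal D\times\mathcal Z$, which is assumed to exist, the running time-averages satisfy, for every $t\ge2$, $$-\frac{\alpha_{\boldsymbol\mu,\mathbf z}+\alpha_{\mathbf w,\mathbf D}}{2\sqrt{t-1}}\le \phi(\mathbf w_t^{\mathrm{av}},\mathbf D_t^{\mathrm{av}},\boldsymbol\mu_t^{\mathrm{av}},\mathbf z_t^{\mathrm{av}})-\phi(\mathbf w^*,\mathbf D^*,\boldsymbol\mu^*,\mathbf z^* )\le\frac{\alpha_{\mathbf w,\mathbf D}+\alpha_{\boldsymbol\mu,\mathbf z}}{2\sqrt{t-1}},$$ where $\alpha_{\mathbf w,\mathbf D}:=\frac{\sqrt2}{\sqrt2-1}\hat\alpha_{\mathbf w,\mathbf D}$ with $$\hat\alpha_{\mathbf w,\mathbf D}:=4(B_{\mathbf w}^2+B_{\mathbf D}^2)+6(H_{\mathbf w}^2+H_{\mathbf D}^2)+H_{\mathbf D}(3+\sigma\overline\Lambda)C_u(B_{\mathbf D}+2H_{\mathbf D}),$$ $\alpha_{\boldsymbol\mu,\mathbf z}:=\frac{\sqrt2}{\sqrt2-1}\hat\alpha_{\boldsymbol\mu,\mathbf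 z}$ with $$\hat\alpha_{\boldsymbol\mu,\mathbf z}:=4(B_{\boldsymbol\mu}^2+B_{\mathbf z}^2)+6(H_{\boldsymbol\mu}^2+H_{\mathbf z}^2)+H_{\mathbf z}(3+\sigma\overline\Lambda)C_u(B_{\mathbf z}+2H_{\mathbf z}),$$ and $$C_u:=\frac{2^5/3^2}{1-\big(1-\frac{\tilde\delta}{4N^2}\big)^{1/B}}.$$
   Context: **Saddle-point data.** $\mathcal W\subseteq\mathbb R^{d_w}$, $\mathcal D\subseteq\mathbb R^{d_D}$, $\mathcal M\subseteq\mathbb R^{d_\mu}$, $\mathcal Z\subseteq\mathbb R^{d_z}$ are closed convex sets, $S:=\mathcal W\times\mathcal D^N\times\mathcal M\times\mathcal Z^N$, and $\phi:S\to\mathbb R$, $(\mathbf w,\mathbf D,\boldsymbol\mu,\mathbf z)\mapsto\phi(\mathbf w,\mathbf D,\boldsymbol\mu,\mathbf z)$, is jointly convex in $(\mathbf w,\mathbf D)$ and jointly concave in $(\boldsymbol\mu,\mathbf z)$; $\mathbf D=(D^1,\dots,D^N)$ and $\mathbf z=(z^1,\dots,z^N)$ with $D^i\in\mathcal D$, $z^i\in\mathcal Z$. A saddle point of $\phi$ on $S$ is a point $(\mathbf w^*,\mathbf D^*,\boldsymbol\mu^*,\mathbf z^* )\in S$ with $\phi(\mathbf w^*,\mathbf D^*,\boldsymbol\mu,\mathbf z)\le\phi(\mathbf w^*,\mathbf D^*,\boldsymbol\mu^*,\mathbf z^* )\le\phi(\mathbf w,\mathbf D,\boldsymbol\mu^*,\mathbf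 z^* )$ for all $(\mathbf w,\mathbf D,\boldsymbol\mu,\mathbf z)\in S$. **Graphs.** A weighted digraph $\mathcal G_t$ on vertex set $\{1,\dots,N\}$ is given by an entrywise nonnegative adjacency matrix $\mathsf A_t=(\mathsf a_{ij,t})\in\mathbb R^{N\times N}$, with $(i,j)$ an edge iff $\mathsf a_{ij,t}>0$. $d_{\mathrm{out},t}(i)=\sum_j\mathsf a_{ij,t}$; the Laplacian is $\mathsf L_t=\mathrm{diag}(\mathsf A_t\mathbf 1_N)-\mathsf A_t$; $\mathcal G_t$ is weight-balanced if $\sum_j\mathsf a_{ij,t}=\sum_j\mathsf a_{ji,t}$ for all $i$. The sequence is $\delta$-nondegenerate ($\delta>0$) if $\mathsf a_{ij,t}>\delta$ whenever $\mathsf a_{ij,t}>0$; it is $B$-jointly connected ($B\in\mathbb Z_{\ge1}$) if for each $k\in\mathbb Z_{\ge1}$ the union digraph $\mathcal G_{kB}\cup\dots\cup\mathcal G_{(k+1)B-1}$ (union of edge sets) is strongly connected. $\sigma_{\max}$ denotes the largest singular value. **Dynamics.** Write $\mathbf L_t=\mathsf L_t\otimes I_d$ with $d=d_D$ or $d=d_z$ according to the vector it multiplies. Given an initial point in $S$, a consensus stepsize $\sigma>0$ and learning rates $\eta_t>0$, $$\hat{\mathbf w}_{t+1}=\mathbf w_t-\eta_tg_{\mathbf w_t},\quad \hat{\mathbf D}_{t+1}=\mathbf D_t-\sigma\mathbf L_t\mathbf D_t-\eta_tg_{\mathbf D_t},\quad \hat{\boldsymbol\mu}_{t+1}=\boldsymbol\mu_t+\eta_tg_{\boldsymbol\mu_t},\quad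 \hat{\mathbf z}_{t+1}=\mathbf z_t-\sigma\mathbf L_t\mathbf z_t+\eta_tg_{\mathbf z_t},$$ $$(\mathbf w_{t+1},\mathbf D_{t+1},\boldsymbol\mu_{t+1},\mathbf z_{t+1})=\mathcal P_S(\hat{\mathbf w}_{t+1},\hat{\mathbf D}_{t+1},\hat{\boldsymbol\mu}_{t+1},\hat{\mathbf z}_{t+1}),$$ where $\mathcal P_S$ is the Euclidean orthogonal projection onto $S$. Here $g_{\mathbf w_t}\in\partial_{\mathbf w}\phi$, $g_{\mathbf D_t}\in\partial_{\mathbf D}\phi$, $g_{\boldsymbol\mu_t}\in\partial_{\boldsymbol\mu}\phi$, $g_{\mathbf z_t}\in\partial_{\mathbf z}\phi$, all evaluated at $(\mathbf w_t,\mathbf D_t,\boldsymbol\mu_t,\mathbf z_t)$, where $\partial_{\mathbf w},\partial_{\mathbf D},\partial_{\boldsymbol\mu},\partial_{\mathbf z}$ denote the set of subgradients with respect to the indicated argument (a vector $\xi$ is a subgradient of a concave $f$ at $x$ if $-\xi$ is a subgradient of the convex function $-f$ at $x$). **Running time-averages.** For $t\ge1$, $\mathbf w_{t+1}^{\mathrm{av}}=\frac1t\sum_{s=1}^t\mathbf w_s$, and likewise $\mathbf D_{t+1}^{\mathrm{av}},\boldsymbol\mu_{t+1}^{\mathrm{av}},\mathbf z_{t+1}^{\mathrm{av}}$.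
   Formalization: (g_w, g_D) is required to be a joint subgradient of φ in (w, D), and (g_μ, g_z) a joint one in (μ, z), rather than four separate partial subgradients; with only separate partial subgradients the claim fails for nonsmooth φ, e.g. |w−D|+(w+D)/10 on [−1,1]² started at (0,0). *)

theory Defs
  imports "HOL-Analysis.Analysis"
begin

section \<open>Weighted digraphs on a finite vertex type\<close>

definition edges :: "real^'n^'n \<Rightarrow> ('n \<times> 'n) set" where
  "edges A = {(i, j). A $ i $ j > 0}"

definition out_degree :: "real^'n^'n \<Rightarrow> 'n::finite \<Rightarrow> real" where
  "out_degree A i = (\<Sum>j\<in>UNIV. A $ i $ j)"

definition laplacian :: "real^'n^'n \<Rightarrow> real^'n^('n::finite)" where
  "laplacian A = (\<chi> i j. if i = j then (A *v 1) $ i else 0) - A"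

definition weight_balanced :: "real^'n^'n \<Rightarrow> bool" where
  "weight_balanced A \<longleftrightarrow> (\<forall>i. (\<Sum>j\<in>UNIV. A $ i $ j) = (\<Sum>j\<in>UNIV. A $ j $ i))"

definition nondegenerate :: "real \<Rightarrow> (nat \<Rightarrow> real^'n^'n) \<Rightarrow> bool" where
  "nondegenerate \<delta> A \<longleftrightarrow> (\<forall>t\<ge>1. \<forall>i j. A t $ i $ j > 0 \<longrightarrow> A t $ i $ j > \<delta>)"

definition strongly_connected_edges :: "('n \<times> 'n) set \<Rightarrow> bool" where
  "strongly_connected_edges E \<longleftrightarrow> (\<forall>i j. (i, j) \<in> E\<^sup>*)"

definition jointly_connected :: "nat \<Rightarrow> (nat \<Rightarrow> real^'n^'n) \<Rightarrow> bool" where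
  "jointly_connected B A \<longleftrightarrow>
     (\<forall>k\<ge>1. strongly_connected_edges (\<Union>t\<in>{k * B..(k + 1) * B - 1}. edges (A t)))"

definition singular_values :: "real^'n^'m \<Rightarrow> real set" where
  "singular_values A =
     {s. s \<ge> 0 \<and> (\<exists>v. v \<noteq> 0 \<and> (transpose A ** A) *v v = s\<^sup>2 *\<^sub>R v)}"

definition sigma_max :: "real^'n^'m \<Rightarrow> real" where
  "sigma_max A = Max (singular_values A)"

text \<open>
  A stacked vector in \<open>(\<real>\<^sup>d)\<^sup>N\<close> has type \<^typ>\<open>(real^'d)^'n\<close>, whose norm is the Euclidean norm of
  all \<open>N d\<close> coordinates. The following is multiplication by \<open>L \<otimes> I\<^sub>d\<close>.
\<close>

definition kron_id_mult :: "real^'n^'n \<Rightarrow> (real^'d)^('n::finite) \<Rightarrow> (real^'d)^'n" where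
  "kron_id_mult L x = (\<chi> i. \<Sum>j\<in>UNIV. L $ i $ j *\<^sub>R x $ j)"

section \<open>Saddle points and subgradients\<close>

definition copies :: "'a set \<Rightarrow> ('a^'n) set" where
  "copies X = {x. \<forall>i. x $ i \<in> X}"

definition saddle_domain ::
  "(real^'w) set \<Rightarrow> (real^'d) set \<Rightarrow> (real^'m) set \<Rightarrow> (real^'z) set \<Rightarrow>
   ((real^'w) \<times> ((real^'d)^'n) \<times> (real^'m) \<times> ((real^'z)^'n)) set" where
  "saddle_domain W \<D> M Z = W \<times> copies \<D> \<times> M \<times> copies Z"

definition is_saddle_point ::
  "(real^'w) set \<Rightarrow> (real^'d) set \<Rightarrow> (real^'m) set \<Rightarrow> (real^'z) set \<Rightarrow>
   (real^'w \<Rightarrow> (real^'d)^'n \<Rightarrow> real^'m \<Rightarrow> (real^'z)^'n \<Rightarrow> real) \<Rightarrow>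
   real^'w \<Rightarrow> (real^'d)^'n \<Rightarrow> real^'m \<Rightarrow> (real^'z)^'n \<Rightarrow> bool" where
  "is_saddle_point W \<D> M Z \<phi> ws Ds \<mu>s zs \<longleftrightarrow>
     (ws, Ds, \<mu>s, zs) \<in> saddle_domain W \<D> M Z \<and>
     (\<forall>(w, D, \<mu>, z) \<in> saddle_domain W \<D> M Z.
        \<phi> ws Ds \<mu> z \<le> \<phi> ws Ds \<mu>s zs \<and> \<phi> ws Ds \<mu>s zs \<le> \<phi> w D \<mu>s zs)"

definition subgradient_on :: "'a::real_inner set \<Rightarrow> ('a \<Rightarrow> real) \<Rightarrow> 'a \<Rightarrow> 'a \<Rightarrow> bool" where
  "subgradient_on X f x \<xi> \<longleftrightarrow> x \<in> X \<and> (\<forall>y\<in>X. f y \<ge> f x + \<xi> \<bullet> (y - x))"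

definition concave_subgradient_on :: "'a::real_inner set \<Rightarrow> ('a \<Rightarrow> real) \<Rightarrow> 'a \<Rightarrow> 'a \<Rightarrow> bool" where
  "concave_subgradient_on X f x \<xi> \<longleftrightarrow> subgradient_on X (\<lambda>y. - f y) x (- \<xi>)"

lemma subgradient_on_Times:
  assumes "subgradient_on (X \<times> Y) f (x, y) (\<xi>, \<zeta>)"
  shows "subgradient_on X (\<lambda>x'. f (x', y)) x \<xi>"
    and "subgradient_on Y (\<lambda>y'. f (x, y')) y \<zeta>"
proof -
  have m: "x \<in> X" "y \<in> Y"
    and le: "\<And>x' y'. x' \<in> X \<Longrightarrow> y' \<in> Y \<Longrightarrow> f (x, y) + (\<xi> \<bullet> (x' - x) + \<zeta> \<bullet> (y' - y)) \<le> f (x', y')"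
    using assms by (auto simp: subgradient_on_def inner_prod_def)
  show "subgradient_on X (\<lambda>x'. f (x', y)) x \<xi>"
    using m le[OF _ m(2)] by (simp add: subgradient_on_def)
  show "subgradient_on Y (\<lambda>y'. f (x, y')) y \<zeta>"
    using m le[OF m(1)] by (simp add: subgradient_on_def)
qed

text \<open>
  The converse fails for nonsmooth functions: zero can be a subgradient in each of the two
  arguments separately at a point that is not a minimiser, where the dynamics below could rest.
\<close>

lemma separate_subgradients_do_not_combine:
  fixes f :: "real \<times> real \<Rightarrow> real"
  defines "f \<equiv> \<lambda>(w, D). \<bar>w - D\<bar> + (w + D) / 10"
  shows "convex_on ({-1..1} \<times> {-1..1}) f"
    and "subgradient_on {-1..1} (\<lambda>w. f (w, 0)) 0 0"
    and "subgradient_on {-1..1} (\<lambda>D. f (0, D)) 0 0"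
    and "f (-1, -1) < f (0, 0)"
    and "\<not> subgradient_on ({-1..1} \<times> {-1..1}) f (0, 0) (0, 0)"
proof -
  show "convex_on ({-1..1} \<times> {-1..1}) f"
    unfolding convex_on_def
  proof (intro conjI ballI allI impI)
    show "convex ({-1..1::real} \<times> {-1..1::real})"
      by (intro convex_Times) auto
    fix x y :: "real \<times> real" and u v :: real
    assume uv: "0 \<le> u" "0 \<le> v"
    obtain a b c d where [simp]: "x = (a, b)" "y = (c, d)"
      by (cases x, cases y)
    have "\<bar>u * (a - b) + v * (c - d)\<bar> \<le> u * \<bar>a - b\<bar> + v * \<bar>c - d\<bar>"
      using uv abs_triangle_ineq[of "u * (a - b)" "v * (c - d)"] by (simp add: abs_mult)
    then show "f (u *\<^sub>R x + v *\<^sub>R y) \<le> u * f x + v * f y"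
      by (simp add: f_def algebra_simps add_divide_distrib)
  qed
  show "subgradient_on {-1..1} (\<lambda>w. f (w, 0)) 0 0" "subgradient_on {-1..1} (\<lambda>D. f (0, D)) 0 0"
    by (auto simp: subgradient_on_def f_def)
  show *: "f (-1, -1) < f (0, 0)"
    by (simp add: f_def)
  have "(-1, -1) \<in> {-1..1::real} \<times> {-1..1::real}"
    by simp
  with * show "\<not> subgradient_on ({-1..1} \<times> {-1..1}) f (0, 0) (0, 0)"
    unfolding subgradient_on_def zero_prod_def[symmetric] inner_zero_left
    by (metis add.right_neutral not_le)
qed

section \<open>Saddle-point dynamics with Laplacian averaging\<close>

text \<open>
  The pair \<open>(gw t, gD t)\<close> is a subgradient of \<open>\<phi>\<close> in the joint convex argument \<open>(w, D)\<close>, and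
  \<open>(g\<mu> t, gz t)\<close> a subgradient in the joint concave argument \<open>(\<mu>, z)\<close>; the components are then
  subgradients in the individual arguments by \<open>subgradient_on_Times\<close>.
\<close>

definition saddle_dynamics ::
  "(real^'w) set \<Rightarrow> (real^'d) set \<Rightarrow> (real^'m) set \<Rightarrow> (real^'z) set \<Rightarrow>
   (real^'w \<Rightarrow> (real^'d)^'n \<Rightarrow> real^'m \<Rightarrow> (real^'z)^'n \<Rightarrow> real) \<Rightarrow>
   (nat \<Rightarrow> real^'n^('n::finite)) \<Rightarrow> real \<Rightarrow> (nat \<Rightarrow> real) \<Rightarrow>
   (nat \<Rightarrow> real^'w) \<Rightarrow> (nat \<Rightarrow> (real^'d)^'n) \<Rightarrow> (nat \<Rightarrow> real^'m) \<Rightarrow> (nat \<Rightarrow> (real^'z)^'n) \<Rightarrow>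
   (nat \<Rightarrow> real^'w) \<Rightarrow> (nat \<Rightarrow> (real^'d)^'n) \<Rightarrow> (nat \<Rightarrow> real^'m) \<Rightarrow> (nat \<Rightarrow> (real^'z)^'n) \<Rightarrow>
   bool" where
  "saddle_dynamics W \<D> M Z \<phi> A \<sigma> \<eta> w D \<mu> z gw gD g\<mu> gz \<longleftrightarrow>
     \<sigma> > 0 \<and> (\<forall>t\<ge>1. \<eta> t > 0) \<and>
     (w 1, D 1, \<mu> 1, z 1) \<in> saddle_domain W \<D> M Z \<and>
     (\<forall>t\<ge>1.
        subgradient_on (W \<times> copies \<D>) (\<lambda>(w', D'). \<phi> w' D' (\<mu> t) (z t)) (w t, D t) (gw t, gD t) \<and>
        concave_subgradient_on (M \<times> copies Z) (\<lambda>(\<mu>', z'). \<phi> (w t) (D t) \<mu>' z')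
          (\<mu> t, z t) (g\<mu> t, gz t) \<and>
        (w (t + 1), D (t + 1), \<mu> (t + 1), z (t + 1)) =
          closest_point (saddle_domain W \<D> M Z)
            (w t - \<eta> t *\<^sub>R gw t,
             D t - \<sigma> *\<^sub>R kron_id_mult (laplacian (A t)) (D t) - \<eta> t *\<^sub>R gD t,
             \<mu> t + \<eta> t *\<^sub>R g\<mu> t,
             z t - \<sigma> *\<^sub>R kron_id_mult (laplacian (A t)) (z t) + \<eta> t *\<^sub>R gz t))"

definition doubling_trick :: "(nat \<Rightarrow> real) \<Rightarrow> bool" where
  "doubling_trick \<eta> \<longleftrightarrow> (\<forall>m. \<forall>s\<in>{2 ^ m..2 ^ (m + 1) - 1}. \<eta> s = 1 / sqrt (2 ^ m))"

text \<open>\<open>time_avg x t\<close> averages \<open>x 1, \<dots>, x (t - 1)\<close>; it is meaningful for \<open>t \<ge> 2\<close>.\<close>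

definition time_avg :: "(nat \<Rightarrow> 'a::real_vector) \<Rightarrow> nat \<Rightarrow> 'a" where
  "time_avg x t = (1 / real (t - 1)) *\<^sub>R (\<Sum>s=1..t - 1. x s)"

section \<open>Constants of the convergence bound\<close>

definition C_u :: "real \<Rightarrow> nat \<Rightarrow> nat \<Rightarrow> real" where
  "C_u \<delta>t N B = (2 ^ 5 / 3 ^ 2) / (1 - (1 - \<delta>t / (4 * (real N)\<^sup>2)) powr (1 / real B))"

text \<open>The second pair of bounds, \<open>b\<^sub>2\<close> and \<open>h\<^sub>2\<close>, belongs to the variable that is averaged over the network.\<close>

definition alpha_hat :: "real \<Rightarrow> real \<Rightarrow> real \<Rightarrow> real \<Rightarrow> real \<Rightarrow> real \<Rightarrow> real \<Rightarrow> real" where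
  "alpha_hat \<sigma> \<Lambda> C b\<^sub>1 b\<^sub>2 h\<^sub>1 h\<^sub>2 =
     4 * (b\<^sub>1\<^sup>2 + b\<^sub>2\<^sup>2) + 6 * (h\<^sub>1\<^sup>2 + h\<^sub>2\<^sup>2) + h\<^sub>2 * (3 + \<sigma> * \<Lambda>) * C * (b\<^sub>2 + 2 * h\<^sub>2)"

definition alpha :: "real \<Rightarrow> real \<Rightarrow> real \<Rightarrow> real \<Rightarrow> real \<Rightarrow> real \<Rightarrow> real \<Rightarrow> real" where
  "alpha \<sigma> \<Lambda> C b\<^sub>1 b\<^sub>2 h\<^sub>1 h\<^sub>2 = sqrt 2 / (sqrt 2 - 1) * alpha_hat \<sigma> \<Lambda> C b\<^sub>1 b\<^sub>2 h\<^sub>1 h\<^sub>2"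

end

theory Submission
  imports Defs
begin

text \<open>
  Each player runs a projected subgradient method interleaved with the doubly stochastic averaging
  \<open>I - \<sigma> L\<close>. Sorting the states at the start of a connectivity window and charging every gap between
  consecutive values to the first step that communicates across it shows that a window contracts the
  variance by the factor \<open>1 - \<delta>t / (2 N\<^sup>2)\<close>. Hence the summed disagreement of a player over an epoch of the
  doubling trick is at most a constant multiple of \<open>b + h\<close> times the square root of the epoch length,
  where \<open>b\<close> and \<open>h\<close> bound its iterates and subgradients. Since averaging does not increase the distance
  to a consensus point, the usual regret estimate holds up to this disagreement, and the regrets of
  both players, divided by the horizon, bound the saddle gap of the averages.
\<close>

section \<open>Dissipation across cuts\<close>

text \<open>The bound must not involve the norm of the saddle point, so time averages serve as
  comparison points: they lie in the same balls as the iterates. But they are not in consensus,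
  while averaging is only known not to increase distances to consensus points. Regret is therefore
  stated against arbitrary \<open>p\<close>: it is taken against \<open>consensus p\<close>, and the
  difference costs \<open>H * disagreement p\<close> per step. The disagreement of an average is at
  most the average disagreement, so this cost is of order 1/sqrt n like the regret itself.

  The constant \<open>C_u\<close> is built from a per-step factor
  \<open>(1 - h) powr (1 / B)\<close> with \<open>h = \<delta>t / (4 * N^2)\<close>, whereas the
  argument yields \<open>B + B / h\<close>: a wait of at most \<open>B\<close> steps for a window to
  begin, then a geometric series over windows of ratio \<open>1 - h\<close>. Bernoulli's inequality
  bounds this by \<open>3 / 8 * C_u\<close>, and 3/8 is small enough for the at most four
  disagreement terms of a player to fit under the coefficient 3 in \<open>alpha_hat\<close>.\<close>

definition doubly_stochastic :: "real^'n^'n::finite \<Rightarrow> bool" where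
  "doubly_stochastic P \<longleftrightarrow> (\<forall>i j. 0 \<le> P $ i $ j) \<and> (\<forall>i. (\<Sum>j\<in>UNIV. P $ i $ j) = 1) \<and>
     (\<forall>j. (\<Sum>i\<in>UNIV. P $ i $ j) = 1)"

text \<open>This is the Jensen deficit of the square. The form over pairs is what later allows the
  loss to be distributed over cuts.\<close>

lemma weighted_variance_eq:
  fixes p x :: "'n::finite \<Rightarrow> real"
  assumes "(\<Sum>i\<in>UNIV. p i) = 1"
  shows "(\<Sum>i\<in>UNIV. p i * (x i)\<^sup>2) - (\<Sum>i\<in>UNIV. p i * x i)\<^sup>2
    = (\<Sum>i\<in>UNIV. \<Sum>j\<in>UNIV. p i * p j * (x i - x j)\<^sup>2) / 2"
proof -
  have "(\<Sum>i\<in>UNIV. \<Sum>j\<in>UNIV. p i * p j * (x i - x j)\<^sup>2)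
      = (\<Sum>i\<in>UNIV. \<Sum>j\<in>UNIV. (p i * (x i)\<^sup>2) * p j) + (\<Sum>i\<in>UNIV. \<Sum>j\<in>UNIV. p i * (p j * (x j)\<^sup>2))
        - 2 * (\<Sum>i\<in>UNIV. \<Sum>j\<in>UNIV. (p i * x i) * (p j * x j))"
    by (simp add: power2_diff algebra_simps sum.distrib sum_subtractf sum_distrib_left)
  also have "\<dots> = 2 * (\<Sum>i\<in>UNIV. p i * (x i)\<^sup>2) - 2 * (\<Sum>i\<in>UNIV. p i * x i)\<^sup>2"
    using assms
    by (simp add: sum_distrib_left[symmetric] sum_distrib_right[symmetric] power2_eq_square)
  finally show ?thesis by simp
qed

text \<open>Unit column sums distribute the energy of \<open>x\<close> over the rows; each row then
  loses the variance of \<open>x\<close> under its own weights.\<close>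

lemma energy_decrease_eq:
  fixes P :: "real^'n^'n::finite"
  assumes "doubly_stochastic P"
  shows "(\<Sum>i\<in>UNIV. (x $ i)\<^sup>2) - (\<Sum>i\<in>UNIV. ((P *v x) $ i)\<^sup>2)
    = (\<Sum>k\<in>UNIV. (\<Sum>i\<in>UNIV. \<Sum>j\<in>UNIV. P $ k $ i * P $ k $ j * (x $ i - x $ j)\<^sup>2) / 2)"
proof -
  have "(\<Sum>k\<in>UNIV. \<Sum>i\<in>UNIV. P $ k $ i * (x $ i)\<^sup>2) = (\<Sum>i\<in>UNIV. \<Sum>k\<in>UNIV. P $ k $ i * (x $ i)\<^sup>2)"
    by (rule sum.swap)
  also have "\<dots> = (\<Sum>i\<in>UNIV. (x $ i)\<^sup>2)"
    using assms by (simp add: doubly_stochastic_def sum_distrib_right[symmetric])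
  finally have "(\<Sum>i\<in>UNIV. (x $ i)\<^sup>2) - (\<Sum>i\<in>UNIV. ((P *v x) $ i)\<^sup>2)
      = (\<Sum>k\<in>UNIV. (\<Sum>i\<in>UNIV. P $ k $ i * (x $ i)\<^sup>2) - (\<Sum>i\<in>UNIV. P $ k $ i * x $ i)\<^sup>2)"
    by (simp add: matrix_vector_mult_def sum_subtractf)
  also have "\<dots> = (\<Sum>k\<in>UNIV. (\<Sum>i\<in>UNIV. \<Sum>j\<in>UNIV. P $ k $ i * P $ k $ j * (x $ i - x $ j)\<^sup>2) / 2)"
    using assms by (intro sum.cong refl weighted_variance_eq) (simp add: doubly_stochastic_def)
  finally show ?thesis .
qed

lemma energy_decrease_nonneg:
  fixes P :: "real^'n^'n::finite"
  assumes "doubly_stochastic P"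
  shows "(\<Sum>i\<in>UNIV. ((P *v x) $ i)\<^sup>2) \<le> (\<Sum>i\<in>UNIV. (x $ i)\<^sup>2)"
proof -
  have "0 \<le> (\<Sum>k\<in>UNIV. (\<Sum>i\<in>UNIV. \<Sum>j\<in>UNIV. P $ k $ i * P $ k $ j * (x $ i - x $ j)\<^sup>2) / 2)"
    using assms by (auto simp: doubly_stochastic_def intro!: sum_nonneg)
  then show ?thesis using energy_decrease_eq[OF assms, of x] by linarith
qed

lemma ex_sorting_bijection:
  fixes y :: "'n::finite \<Rightarrow> real"
  obtains f where "bij_betw f {..<CARD('n)} (UNIV :: 'n set)"
    "\<And>a b. a \<le> b \<Longrightarrow> b < CARD('n) \<Longrightarrow> y (f a) \<le> y (f b)"
proof -
  obtain xs where xs: "set xs = (UNIV :: 'n set)" "distinct xs"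
    using finite_distinct_list[OF finite] by blast
  define ys where "ys = sort_key y xs"
  have ys: "set ys = UNIV" "distinct ys" "sorted (map y ys)"
    using xs by (auto simp: ys_def)
  have len: "length ys = CARD('n)"
    using distinct_card[OF ys(2)] ys(1) by simp
  show thesis
  proof
    show "bij_betw (\<lambda>i. ys ! i) {..<CARD('n)} UNIV"
      using bij_betw_nth[OF ys(2), of "{..<CARD('n)}" UNIV] ys(1) len by auto
    show "y (ys ! a) \<le> y (ys ! b)" if "a \<le> b" "b < CARD('n)" for a b
      using sorted_nth_mono[OF ys(3), of a b] that len by simp
  qed
qed

text \<open>Weight in either direction counts, so that without a crossing both \<open>S\<close> and
  its complement average only among themselves.\<close>

definition crosses :: "real^'n^'n \<Rightarrow> 'n set \<Rightarrow> bool" where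
  "crosses P S \<longleftrightarrow> (\<exists>i j. P $ i $ j > 0 \<and> (i \<in> S) \<noteq> (j \<in> S))"

lemma strongly_connected_edges_crosses:
  assumes sc: "strongly_connected_edges (\<Union>t\<in>T. E t)"
    and E: "\<And>t i j. t \<in> T \<Longrightarrow> (i, j) \<in> E t \<Longrightarrow> i \<noteq> j \<Longrightarrow> P t $ i $ j > 0"
    and S: "a \<in> S" "b \<notin> S"
  shows "\<exists>t\<in>T. crosses (P t) S"
proof (rule ccontr)
  assume no: "\<not> ?thesis"
  have "(a, b) \<in> (\<Union>t\<in>T. E t)\<^sup>*"
    using sc by (simp add: strongly_connected_edges_def)
  then have "b \<in> S"
  proof (induction rule: rtrancl_induct)
    case base
    then show ?case using S by simp
  next
    case (step i j)
    then obtain t where "t \<in> T" "(i, j) \<in> E t" by auto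
    then show ?case using no E[of t i j] step.IH unfolding crosses_def by metis
  qed
  with S show False by simp
qed

text \<open>A crossing entry \<open>(i, j)\<close> forces row \<open>i\<close> to put weight at
  least \<open>c\<close> on each side: \<open>P $ i $ i\<close> on its own side and
  \<open>P $ i $ j\<close> on the other. Since the two weights sum to 1, their product is at least
  \<open>c * (1 - c)\<close>, hence at least \<open>c / 2\<close>.\<close>

lemma crossing_weight_ge:
  fixes P :: "real^'n^'n::finite"
  assumes P: "doubly_stochastic P" and diag: "\<And>i. P $ i $ i \<ge> c"
    and off: "\<And>i j. P $ i $ j > 0 \<Longrightarrow> P $ i $ j \<ge> c" and c: "c > 0"
    and cr: "crosses P S"
  shows "c / 2 \<le> (\<Sum>k\<in>UNIV. (\<Sum>i\<in>S. P $ k $ i) * (\<Sum>j\<in>-S. P $ k $ j))"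
proof -
  have nn: "P $ i $ j \<ge> 0" for i j
    using P by (simp add: doubly_stochastic_def)
  obtain i j where ij: "P $ i $ j > 0" "(i \<in> S) \<noteq> (j \<in> S)"
    using cr by (auto simp: crosses_def)
  define q r where "q = (\<Sum>l\<in>S. P $ i $ l)" and "r = (\<Sum>l\<in>-S. P $ i $ l)"
  have "q + r = (\<Sum>l\<in>UNIV. P $ i $ l)"
    unfolding q_def r_def using sum.union_disjoint[of S "-S" "\<lambda>l. P $ i $ l"] by simp
  then have qr: "q + r = 1"
    using P by (simp add: doubly_stochastic_def)
  have mem: "l \<in> T \<Longrightarrow> P $ i $ l \<le> (\<Sum>l\<in>T. P $ i $ l)" for l T
    by (rule member_le_sum) (auto simp: nn)
  have "c \<le> P $ i $ i" "c \<le> P $ i $ j"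
    using diag off ij by auto
  then have "c \<le> q" "c \<le> r"
    using ij(2) mem[of i S] mem[of j S] mem[of i "-S"] mem[of j "-S"] unfolding q_def r_def
    by (auto simp del: sum.cong intro: order_trans)
  then have "(q - c) * (r - c) \<ge> 0" "2 * c \<le> 1"
    using qr by auto
  moreover have "(q - c) * (r - c) = q * r - c * (q + r) + c * c"
    by (simp add: algebra_simps)
  moreover have "c * (2 * c) \<le> c * 1"
    using c \<open>2 * c \<le> 1\<close> by (intro mult_left_mono) auto
  ultimately have "c / 2 \<le> q * r"
    using qr by simp
  also have "\<dots> \<le> (\<Sum>k\<in>UNIV. (\<Sum>i\<in>S. P $ k $ i) * (\<Sum>j\<in>-S. P $ k $ j))"
    unfolding q_def r_def
    by (rule member_le_sum[where f = "\<lambda>k. (\<Sum>i\<in>S. P $ k $ i) * (\<Sum>j\<in>-S. P $ k $ j)"])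
       (auto simp: nn intro!: sum_nonneg mult_nonneg_nonneg)
  finally show ?thesis .
qed

lemma convex_combination_le_on:
  fixes p x :: "'n::finite \<Rightarrow> real"
  assumes "\<And>j. 0 \<le> p j" "(\<Sum>j\<in>UNIV. p j) = 1" "\<And>j. p j > 0 \<Longrightarrow> x j \<le> b"
  shows "(\<Sum>j\<in>UNIV. p j * x j) \<le> b"
proof -
  have "p j * x j \<le> p j * b" for j
    using assms(1,3)[of j] by (cases "p j = 0") (auto intro: mult_left_mono)
  then have "(\<Sum>j\<in>UNIV. p j * x j) \<le> (\<Sum>j\<in>UNIV. p j * b)"
    by (rule sum_mono)
  also have "\<dots> = b"
    using assms(2) by (simp add: sum_distrib_right[symmetric])
  finally show ?thesis .
qed

lemma sum_power2_le_power2_sum: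
  fixes g :: "'a \<Rightarrow> real"
  assumes "finite F" "\<And>d. d \<in> F \<Longrightarrow> 0 \<le> g d"
  shows "(\<Sum>d\<in>F. (g d)\<^sup>2) \<le> (\<Sum>d\<in>F. g d)\<^sup>2"
proof -
  have "(\<Sum>d\<in>F. (g d)\<^sup>2) \<le> (\<Sum>d\<in>F. g d * (\<Sum>d\<in>F. g d))"
    using assms by (intro sum_mono) (auto simp: power2_eq_square intro!: mult_left_mono member_le_sum)
  then show ?thesis by (simp add: sum_distrib_right power2_eq_square)
qed

text \<open>
  The sorted values \<open>Y 0 \<le> \<dots> \<le> Y (N - 1)\<close> of the state at the start of a window define \<open>N - 1\<close>
  cuts \<open>S d\<close>. As long as no weight crosses a cut, its two sides stay separated by the gap
  \<open>Y (Suc d) - Y d\<close>, so a step that crosses the cuts in \<open>C\<close> dissipates all the corresponding gaps.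
\<close>

lemma energy_decrease_ge_crossed_gaps:
  fixes P :: "real^'n^'n::finite" and Y :: "nat \<Rightarrow> real" and S :: "nat \<Rightarrow> 'n set"
  assumes P: "doubly_stochastic P" and diag: "\<And>i. P $ i $ i \<ge> c"
    and off: "\<And>i j. P $ i $ j > 0 \<Longrightarrow> P $ i $ j \<ge> c" and c: "c > 0"
    and fin: "finite C" and Y: "\<And>d. d \<le> Max C \<Longrightarrow> Y d \<le> Y (Suc d)"
    and S: "mono S" and cr: "\<And>d. d \<in> C \<Longrightarrow> crosses P (S d)"
    and below: "\<And>d i. d \<in> C \<Longrightarrow> i \<in> S d \<Longrightarrow> x $ i \<le> Y d"
    and above: "\<And>d i. d \<in> C \<Longrightarrow> i \<notin> S d \<Longrightarrow> Y (Suc d) \<le> x $ i"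
  shows "c / 2 * (\<Sum>d\<in>C. (Y (Suc d) - Y d)\<^sup>2)
    \<le> (\<Sum>i\<in>UNIV. (x $ i)\<^sup>2) - (\<Sum>i\<in>UNIV. ((P *v x) $ i)\<^sup>2)"
proof -
  define g where "g d = Y (Suc d) - Y d" for d
  define F where "F i j = {d\<in>C. i \<in> S d \<and> j \<notin> S d}" for i j
  define s where "s i j = (\<Sum>d\<in>F i j. (g d)\<^sup>2)" for i j
  have nn: "P $ i $ j \<ge> 0" for i j
    using P by (simp add: doubly_stochastic_def)
  have finF: "finite (F i j)" for i j
    using fin by (simp add: F_def)
  \<comment> \<open>One pair pays for all cuts between its endpoints: the squared gaps sum to at
    most the square of their sum. The range \<open>{a..b}\<close> may contain gaps outside
    \<open>C\<close>, which is why \<open>Y\<close> has to be monotone all the way up to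
    \<open>Max C\<close>.\<close>
  have s_le: "s i j \<le> (x $ i - x $ j)\<^sup>2" for i j
  proof (cases "F i j = {}")
    case True
    then show ?thesis by (simp add: s_def)
  next
    case False
    define a b where "a = Min (F i j)" and "b = Max (F i j)"
    have ab: "a \<in> F i j" "b \<in> F i j" "a \<le> b" "F i j \<subseteq> {a..b}"
      using finF[of i j] False by (auto simp: a_def b_def)
    have "b \<le> Max C"
      using ab(2) fin by (auto simp: F_def)
    then have g0: "d \<le> b \<Longrightarrow> 0 \<le> g d" for d
      using Y by (auto simp: g_def)
    have "(\<Sum>d\<in>F i j. g d) \<le> (\<Sum>d\<in>{a..b}. g d)"
      using ab g0 by (intro sum_mono2) auto
    also have "\<dots> = Y (Suc b) - Y a"
      using ab(3) unfolding g_def by (subst sum_Suc_diff) auto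
    also have "\<dots> \<le> x $ j - x $ i"
      using ab(1,2) below[of a i] above[of b j] by (auto simp: F_def)
    finally have le: "(\<Sum>d\<in>F i j. g d) \<le> x $ j - x $ i" .
    have g0': "0 \<le> g d" if "d \<in> F i j" for d
      using g0 ab(4) that by auto
    have "s i j \<le> (\<Sum>d\<in>F i j. g d)\<^sup>2"
      unfolding s_def using finF g0' by (rule sum_power2_le_power2_sum)
    also have "\<dots> \<le> (x $ j - x $ i)\<^sup>2"
      using le g0' by (intro power_mono sum_nonneg) auto
    finally show ?thesis by (simp add: power2_commute)
  qed
  \<comment> \<open>Nested cuts cannot separate \<open>i\<close> from \<open>j\<close> in both
    orders, so one of the two terms vanishes.\<close>
  have s_sym: "s i j + s j i \<le> (x $ i - x $ j)\<^sup>2" for i j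
  proof -
    have "F i j = {} \<or> F j i = {}"
    proof (rule ccontr)
      assume "\<not> ?thesis"
      then obtain d d' where "i \<in> S d" "j \<notin> S d" "j \<in> S d'" "i \<notin> S d'"
        by (auto simp: F_def)
      then show False
        using monoD[OF S, of d d'] monoD[OF S, of d' d] nat_le_linear[of d d'] by blast
    qed
    then show ?thesis
      using s_le[of i j] s_le[of j i] by (auto simp: s_def power2_commute)
  qed
  have per_row: "(\<Sum>d\<in>C. (g d)\<^sup>2 * ((\<Sum>i\<in>S d. P $ k $ i) * (\<Sum>j\<in>-S d. P $ k $ j)))
      \<le> (\<Sum>i\<in>UNIV. \<Sum>j\<in>UNIV. P $ k $ i * P $ k $ j * (x $ i - x $ j)\<^sup>2) / 2" for k
  proof -
    let ?p = "\<lambda>i. P $ k $ i"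
    have "(\<Sum>d\<in>C. (g d)\<^sup>2 * ((\<Sum>i\<in>S d. ?p i) * (\<Sum>j\<in>-S d. ?p j)))
        = (\<Sum>d\<in>C. \<Sum>i\<in>UNIV. \<Sum>j\<in>UNIV. if i \<in> S d \<and> j \<notin> S d then ?p i * ?p j * (g d)\<^sup>2 else 0)"
    proof (intro sum.cong refl)
      fix d
      have "(\<Sum>i\<in>UNIV. \<Sum>j\<in>UNIV. if i \<in> S d \<and> j \<notin> S d then ?p i * ?p j * (g d)\<^sup>2 else 0)
          = (\<Sum>i\<in>UNIV. if i \<in> S d then (\<Sum>j\<in>-S d. ?p i * ?p j * (g d)\<^sup>2) else 0)"
        by (intro sum.cong refl) (auto simp: sum.If_cases Compl_eq)
      also have "\<dots> = (\<Sum>i\<in>S d. \<Sum>j\<in>-S d. ?p i * ?p j * (g d)\<^sup>2)"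
        by (simp add: sum.If_cases)
      finally show "(g d)\<^sup>2 * ((\<Sum>i\<in>S d. ?p i) * (\<Sum>j\<in>-S d. ?p j))
          = (\<Sum>i\<in>UNIV. \<Sum>j\<in>UNIV. if i \<in> S d \<and> j \<notin> S d then ?p i * ?p j * (g d)\<^sup>2 else 0)"
        by (simp only: sum_product) (simp add: sum_distrib_left mult.commute[of _ "(g d)\<^sup>2"])
    qed
    also have "\<dots> = (\<Sum>i\<in>UNIV. \<Sum>d\<in>C. \<Sum>j\<in>UNIV. if i \<in> S d \<and> j \<notin> S d then ?p i * ?p j * (g d)\<^sup>2 else 0)"
      by (rule sum.swap)
    also have "\<dots> = (\<Sum>i\<in>UNIV. \<Sum>j\<in>UNIV. \<Sum>d\<in>C. if i \<in> S d \<and> j \<notin> S d then ?p i * ?p j * (g d)\<^sup>2 else 0)"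
      by (intro sum.cong refl sum.swap)
    also have "\<dots> = (\<Sum>i\<in>UNIV. \<Sum>j\<in>UNIV. ?p i * ?p j * s i j)"
      using fin by (intro sum.cong refl)
        (simp add: s_def F_def sum_distrib_left sum.inter_filter if_distrib cong: if_cong)
    finally have eq: "(\<Sum>d\<in>C. (g d)\<^sup>2 * ((\<Sum>i\<in>S d. ?p i) * (\<Sum>j\<in>-S d. ?p j)))
        = (\<Sum>i\<in>UNIV. \<Sum>j\<in>UNIV. ?p i * ?p j * s i j)" .
    \<comment> \<open>Symmetrising over the pair compensates for the division by 2 in the energy
      identity.\<close>
    have "(\<Sum>i\<in>UNIV. \<Sum>j\<in>UNIV. ?p i * ?p j * s j i) = (\<Sum>i\<in>UNIV. \<Sum>j\<in>UNIV. ?p i * ?p j * s i j)"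
      by (subst sum.swap) (simp add: mult_ac)
    then have "2 * (\<Sum>i\<in>UNIV. \<Sum>j\<in>UNIV. ?p i * ?p j * s i j)
        = (\<Sum>i\<in>UNIV. \<Sum>j\<in>UNIV. ?p i * ?p j * (s i j + s j i))"
      by (simp add: distrib_left sum.distrib)
    also have "\<dots> \<le> (\<Sum>i\<in>UNIV. \<Sum>j\<in>UNIV. ?p i * ?p j * (x $ i - x $ j)\<^sup>2)"
      using s_sym nn by (intro sum_mono mult_left_mono) auto
    finally show ?thesis using eq by simp
  qed
  have "c / 2 * (\<Sum>d\<in>C. (g d)\<^sup>2) = (\<Sum>d\<in>C. (g d)\<^sup>2 * (c / 2))"
    by (simp add: sum_distrib_left mult.commute)
  also have "\<dots> \<le> (\<Sum>d\<in>C. (g d)\<^sup>2 * (\<Sum>k\<in>UNIV. (\<Sum>i\<in>S d. P $ k $ i) * (\<Sum>j\<in>-S d. P $ k $ j)))"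
    using crossing_weight_ge[OF P diag off c cr] by (intro sum_mono mult_left_mono) auto
  also have "\<dots> = (\<Sum>d\<in>C. \<Sum>k\<in>UNIV. (g d)\<^sup>2 * ((\<Sum>i\<in>S d. P $ k $ i) * (\<Sum>j\<in>-S d. P $ k $ j)))"
    by (simp add: sum_distrib_left)
  also have "\<dots> = (\<Sum>k\<in>UNIV. \<Sum>d\<in>C. (g d)\<^sup>2 * ((\<Sum>i\<in>S d. P $ k $ i) * (\<Sum>j\<in>-S d. P $ k $ j)))"
    by (rule sum.swap)
  also have "\<dots> \<le> (\<Sum>k\<in>UNIV. (\<Sum>i\<in>UNIV. \<Sum>j\<in>UNIV. P $ k $ i * P $ k $ j * (x $ i - x $ j)\<^sup>2) / 2)"
    by (intro sum_mono per_row)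
  finally show ?thesis
    using energy_decrease_eq[OF P, of x] by (simp add: g_def)
qed

section \<open>Contraction of the variance over a connectivity window\<close>

text \<open>Not divided by the number of entries, so that summing over coordinates gives exactly the
  squared disagreement.\<close>

definition variance :: "real^'n::finite \<Rightarrow> real" where
  "variance x = (\<Sum>i\<in>UNIV. (x $ i - (\<Sum>j\<in>UNIV. x $ j) / real CARD('n))\<^sup>2)"

text \<open>The parallel-axis identity. With \<open>b = 0\<close> it turns energy decrease into
  variance decrease, because a doubly stochastic step preserves the mean.\<close>

lemma sum_power2_diff_eq_variance:
  fixes x :: "real^'n::finite"
  shows "(\<Sum>i\<in>UNIV. (x $ i - b)\<^sup>2)
    = variance x + real CARD('n) * ((\<Sum>j\<in>UNIV. x $ j) / real CARD('n) - b)\<^sup>2"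
proof -
  define m where "m = (\<Sum>j\<in>UNIV. x $ j) / real CARD('n)"
  have m: "(\<Sum>i\<in>UNIV. x $ i - m) = 0"
    by (simp add: m_def sum_subtractf)
  have "(\<Sum>i\<in>UNIV. (x $ i - b)\<^sup>2) = (\<Sum>i\<in>UNIV. (x $ i - m)\<^sup>2 + 2 * (m - b) * (x $ i - m) + (m - b)\<^sup>2)"
    by (intro sum.cong refl) (simp add: power2_eq_square algebra_simps)
  also have "\<dots> = variance x + 2 * (m - b) * (\<Sum>i\<in>UNIV. x $ i - m) + real CARD('n) * (m - b)\<^sup>2"
    by (simp add: sum.distrib variance_def m_def sum_distrib_left)
  finally show ?thesis using m by (simp add: m_def)
qed

lemma variance_le_sum_power2_diff:
  fixes x :: "real^'n::finite"
  shows "variance x \<le> (\<Sum>i\<in>UNIV. (x $ i - b)\<^sup>2)"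
  unfolding sum_power2_diff_eq_variance[of x b] by simp

lemma doubly_stochastic_sum_eq:
  fixes P :: "real^'n^'n::finite"
  assumes "doubly_stochastic P"
  shows "(\<Sum>i\<in>UNIV. (P *v x) $ i) = (\<Sum>i\<in>UNIV. x $ i)"
proof -
  have "(\<Sum>i\<in>UNIV. (P *v x) $ i) = (\<Sum>j\<in>UNIV. \<Sum>i\<in>UNIV. P $ i $ j * x $ j)"
    unfolding matrix_vector_mult_def by (simp, rule sum.swap)
  then show ?thesis
    using assms by (simp add: doubly_stochastic_def sum_distrib_right[symmetric])
qed

lemma variance_decrease_eq:
  fixes P :: "real^'n^'n::finite"
  assumes "doubly_stochastic P"
  shows "variance x - variance (P *v x)
    = (\<Sum>i\<in>UNIV. (x $ i)\<^sup>2) - (\<Sum>i\<in>UNIV. ((P *v x) $ i)\<^sup>2)"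
  using sum_power2_diff_eq_variance[of x 0] sum_power2_diff_eq_variance[of "P *v x" 0]
    doubly_stochastic_sum_eq[OF assms, of x] by simp

text \<open>Every entry is reached from \<open>x $ f 0\<close> across fewer than N gaps, so
  Cauchy-Schwarz costs one factor N and the sum over the entries another. This is the origin of the
  square of N in the rate.\<close>

lemma variance_le_sum_gaps:
  fixes x :: "real^'n::finite"
  assumes f: "bij_betw f {..<CARD('n)} (UNIV :: 'n set)"
  shows "variance x \<le> (real CARD('n))\<^sup>2 * (\<Sum>d<CARD('n) - 1. (x $ f (Suc d) - x $ f d)\<^sup>2)"
proof -
  let ?N = "CARD('n)"
  let ?G = "\<Sum>d<?N - 1. (x $ f (Suc d) - x $ f d)\<^sup>2"
  have le: "(x $ i - x $ f 0)\<^sup>2 \<le> real ?N * ?G" for i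
  proof -
    obtain k where k: "k < ?N" "i = f k"
      using f by (auto simp: bij_betw_def image_iff)
    have "x $ i - x $ f 0 = (\<Sum>d<k. x $ f (Suc d) - x $ f d)"
      using sum_lessThan_telescope[of "\<lambda>d. x $ f d" k] k by simp
    then have "(x $ i - x $ f 0)\<^sup>2 \<le> real k * (\<Sum>d<k. (x $ f (Suc d) - x $ f d)\<^sup>2)"
      using sum_squared_le_sum_of_squares[of "\<lambda>d. x $ f (Suc d) - x $ f d" "{..<k}"]
      by (simp add: mult.commute)
    also have "\<dots> \<le> real ?N * ?G"
      using k by (intro mult_mono sum_mono2 sum_nonneg) auto
    finally show ?thesis .
  qed
  have "variance x \<le> (\<Sum>i\<in>UNIV. (x $ i - x $ f 0)\<^sup>2)"
    by (rule variance_le_sum_power2_diff)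
  also have "\<dots> \<le> (\<Sum>i\<in>(UNIV::'n set). real ?N * ?G)"
    by (intro sum_mono le)
  finally show ?thesis by (simp add: power2_eq_square mult.assoc)
qed

lemma variance_contraction:
  fixes P :: "nat \<Rightarrow> real^'n^'n::finite" and x :: "nat \<Rightarrow> real^'n"
  assumes P: "\<And>t. t < b \<Longrightarrow> doubly_stochastic (P t)"
    and diag: "\<And>t i. t < b \<Longrightarrow> P t $ i $ i \<ge> c"
    and off: "\<And>t i j. t < b \<Longrightarrow> P t $ i $ j > 0 \<Longrightarrow> P t $ i $ j \<ge> c" and c: "c > 0"
    and cross: "\<And>S. S \<noteq> {} \<Longrightarrow> S \<noteq> UNIV \<Longrightarrow> \<exists>t<b. crosses (P t) S"
    and x: "\<And>t. t < b \<Longrightarrow> x (Suc t) = P t *v x t"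
  shows "variance (x b) \<le> (1 - c / (2 * (real CARD('n))\<^sup>2)) * variance (x 0)"
proof -
  let ?N = "CARD('n)"
  obtain f where f: "bij_betw f {..<?N} (UNIV :: 'n set)"
    and sorted: "\<And>k l. k \<le> l \<Longrightarrow> l < ?N \<Longrightarrow> x 0 $ f k \<le> x 0 $ f l"
    using ex_sorting_bijection[of "\<lambda>i. x 0 $ i"] by metis
  define Y where "Y k = x 0 $ f k" for k
  define S where "S d = f ` {..d}" for d
  \<comment> \<open>The time of the first crossing. For \<open>d >= N - 1\<close> the cut is all of
    \<open>UNIV\<close>, which nothing crosses, and the value is meaningless; all later uses
    restrict \<open>d\<close>.\<close>
  define \<tau> where "\<tau> d = (LEAST t. crosses (P t) (S d))" for d
  have tau: "\<tau> d < b" "crosses (P (\<tau> d)) (S d)" if d: "d < ?N - 1" for d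
  proof -
    have "f (Suc d) \<notin> S d"
    proof
      assume "f (Suc d) \<in> S d"
      then obtain k where "k \<le> d" "f (Suc d) = f k" by (auto simp: S_def)
      moreover have "inj_on f {..<?N}" using f by (simp add: bij_betw_def)
      moreover have "Suc d < ?N" using d by linarith
      ultimately show False using inj_onD[of f "{..<?N}" "Suc d" k] by simp
    qed
    then have "S d \<noteq> {}" "S d \<noteq> UNIV"
      by (auto simp: S_def)
    then obtain t where t: "t < b" "crosses (P t) (S d)"
      using cross by blast
    show "crosses (P (\<tau> d)) (S d)"
      unfolding \<tau>_def using t(2) by (rule LeastI)
    show "\<tau> d < b"
      using Least_le[of "\<lambda>t. crosses (P t) (S d)", OF t(2)] t(1) by (simp add: \<tau>_def)
  qed
  \<comment> \<open>Before time \<open>\<tau> d\<close> every new value is a convex combination of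
    values on its own side. The claim includes the state at \<open>\<tau> d\<close>, to which the
    first crossing step is applied.\<close>
  have separated: "(\<forall>i\<in>S d. x t $ i \<le> Y d) \<and> (\<forall>i. i \<notin> S d \<longrightarrow> Y (Suc d) \<le> x t $ i)"
    if d: "d < ?N - 1" and "t \<le> \<tau> d" for d t
    using that(2)
  proof (induction t)
    case 0
    have "Y (Suc d) \<le> x 0 $ i" if "i \<notin> S d" for i
    proof -
      obtain k where k: "k < ?N" "i = f k"
        using f by (auto simp: bij_betw_def image_iff)
      then have "Suc d \<le> k" using that by (auto simp: S_def not_less_eq_eq[symmetric])
      then show ?thesis using sorted k by (simp add: Y_def)
    qed
    then show ?case using sorted d by (auto simp: S_def Y_def)
  next
    case (Suc t)
    then have IH: "\<And>i. i \<in> S d \<Longrightarrow> x t $ i \<le> Y d" "\<And>i. i \<notin> S d \<Longrightarrow> - x t $ i \<le> - Y (Suc d)"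
      by auto
    have t: "t < b" using Suc.prems tau(1)[OF d] by simp
    have nc: "\<not> crosses (P t) (S d)"
      using Suc.prems not_less_Least[of t "\<lambda>t. crosses (P t) (S d)"] by (simp add: \<tau>_def)
    have row: "\<And>i j. 0 \<le> P t $ i $ j" "\<And>i. (\<Sum>j\<in>UNIV. P t $ i $ j) = 1"
      using P[OF t] by (auto simp: doubly_stochastic_def)
    have "x (Suc t) $ i \<le> Y d" if "i \<in> S d" for i
      unfolding x[OF t] matrix_vector_mult_def vec_lambda_beta
      using nc that IH row by (intro convex_combination_le_on) (auto simp: crosses_def)
    moreover have "Y (Suc d) \<le> x (Suc t) $ i" if "i \<notin> S d" for i
    proof -
      have "(\<Sum>j\<in>UNIV. P t $ i $ j * (- x t $ j)) \<le> - Y (Suc d)"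
        using nc that IH(2) row by (intro convex_combination_le_on) (auto simp: crosses_def)
      then show ?thesis
        unfolding x[OF t] matrix_vector_mult_def by (simp add: sum_negf)
    qed
    ultimately show ?case by blast
  qed
  \<comment> \<open>Cuts first crossed at the same time are charged together to that one step. The
    empty case is separate because \<open>Max\<close> needs a nonempty set.\<close>
  have step: "c / 2 * (\<Sum>d\<in>{d. d < ?N - 1 \<and> \<tau> d = t}. (Y (Suc d) - Y d)\<^sup>2)
      \<le> variance (x t) - variance (x (Suc t))" if t: "t < b" for t
  proof (cases "{d. d < ?N - 1 \<and> \<tau> d = t} = {}")
    case True
    have "0 \<le> variance (x t) - variance (x (Suc t))"
      using energy_decrease_nonneg[OF P[OF t], of "x t"] variance_decrease_eq[OF P[OF t], of "x t"] x[OF t]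
      by simp
    then show ?thesis unfolding True by simp
  next
    case False
    let ?C = "{d. d < ?N - 1 \<and> \<tau> d = t}"
    have fin: "finite ?C" by simp
    have "Max ?C \<in> ?C" using False fin by (intro Max_in) auto
    then have M: "Max ?C < ?N - 1" by simp
    have "c / 2 * (\<Sum>d\<in>?C. (Y (Suc d) - Y d)\<^sup>2)
        \<le> (\<Sum>i\<in>UNIV. (x t $ i)\<^sup>2) - (\<Sum>i\<in>UNIV. ((P t *v x t) $ i)\<^sup>2)"
    proof (rule energy_decrease_ge_crossed_gaps[where S = S and c = c])
      show "Y d \<le> Y (Suc d)" if "d \<le> Max ?C" for d
        using that M sorted by (simp add: Y_def)
      show "mono S" by (auto simp: mono_def S_def)
      show "crosses (P t) (S d)" if "d \<in> ?C" for d using that tau by auto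
      show "x t $ i \<le> Y d" if "d \<in> ?C" "i \<in> S d" for d i using that separated[of d t] by auto
      show "Y (Suc d) \<le> x t $ i" if "d \<in> ?C" "i \<notin> S d" for d i using that separated[of d t] by auto
    qed (use P diag off c t fin in auto)
    then show ?thesis using variance_decrease_eq[OF P[OF t], of "x t"] x[OF t] by simp
  qed
  \<comment> \<open>Each cut has exactly one first crossing time below \<open>b\<close>, so grouping
    by \<open>\<tau>\<close> counts every gap once.\<close>
  have "c / 2 * (\<Sum>d<?N - 1. (Y (Suc d) - Y d)\<^sup>2)
      = (\<Sum>t<b. c / 2 * (\<Sum>d\<in>{d. d < ?N - 1 \<and> \<tau> d = t}. (Y (Suc d) - Y d)\<^sup>2))"
    using sum.group[of "{..<?N - 1}" "{..<b}" \<tau> "\<lambda>d. (Y (Suc d) - Y d)\<^sup>2"] tau(1)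
    unfolding sum_distrib_left[symmetric] by (simp add: image_subset_iff)
  also have "\<dots> \<le> (\<Sum>t<b. variance (x t) - variance (x (Suc t)))"
    by (intro sum_mono step) simp
  also have "\<dots> = variance (x 0) - variance (x b)"
    using sum_lessThan_telescope'[of "\<lambda>t. variance (x t)" b] by simp
  finally have dec: "c / 2 * (\<Sum>d<?N - 1. (Y (Suc d) - Y d)\<^sup>2) \<le> variance (x 0) - variance (x b)" .
  have "c / (2 * (real ?N)\<^sup>2) * variance (x 0)
      \<le> c / (2 * (real ?N)\<^sup>2) * ((real ?N)\<^sup>2 * (\<Sum>d<?N - 1. (Y (Suc d) - Y d)\<^sup>2))"
    using variance_le_sum_gaps[OF f, of "x 0"] c by (intro mult_left_mono) (auto simp: Y_def)
  also have "\<dots> = c / 2 * (\<Sum>d<?N - 1. (Y (Suc d) - Y d)\<^sup>2)"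
    by simp
  finally show ?thesis using dec by (simp add: algebra_simps)
qed

section \<open>Disagreement of stacked vectors\<close>

lemma kron_id_mult_linear:
  "kron_id_mult P (u + v) = kron_id_mult P u + kron_id_mult P v"
  "kron_id_mult P (u - v) = kron_id_mult P u - kron_id_mult P v"
  "kron_id_mult P (a *\<^sub>R v) = a *\<^sub>R kron_id_mult P v"
  by (simp_all add: kron_id_mult_def vec_eq_iff scaleR_add_right scaleR_diff_right sum.distrib
      sum_subtractf scaleR_sum_right mult.commute)

lemma kron_id_mult_component:
  "kron_id_mult P v $ i $ k = (P *v (\<chi> i. v $ i $ k)) $ i"
  by (simp add: kron_id_mult_def matrix_vector_mult_def)

lemma norm_power2_stacked:
  fixes v :: "(real^'d)^'n"
  shows "(norm v)\<^sup>2 = (\<Sum>k\<in>UNIV. \<Sum>i\<in>UNIV. (v $ i $ k)\<^sup>2)"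
proof -
  have "(norm v)\<^sup>2 = (\<Sum>i\<in>UNIV. \<Sum>k\<in>UNIV. (v $ i $ k)\<^sup>2)"
    unfolding power2_norm_eq_inner inner_vec_def by (simp add: power2_eq_square)
  then show ?thesis by (subst (asm) sum.swap)
qed

lemma norm_kron_id_mult_le:
  fixes P :: "real^'n^'n" and v :: "(real^'d)^'n"
  assumes "doubly_stochastic P"
  shows "norm (kron_id_mult P v) \<le> norm v"
proof -
  have "(\<Sum>i\<in>UNIV. (kron_id_mult P v $ i $ k)\<^sup>2) \<le> (\<Sum>i\<in>UNIV. (v $ i $ k)\<^sup>2)" for k
    using energy_decrease_nonneg[OF assms, of "\<chi> i. v $ i $ k"] by (simp add: kron_id_mult_component)
  then have "(norm (kron_id_mult P v))\<^sup>2 \<le> (norm v)\<^sup>2"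
    unfolding norm_power2_stacked by (rule sum_mono)
  then show ?thesis by (rule power2_le_imp_le) simp
qed

lemma kron_id_mult_mem_copies:
  fixes P :: "real^'n^'n" and X :: "(real^'d) set"
  assumes "convex X" "doubly_stochastic P" "v \<in> copies X"
  shows "kron_id_mult P v \<in> copies X"
  using assms unfolding copies_def kron_id_mult_def doubly_stochastic_def
  by (auto intro!: convex_sum)

text \<open>Encoded as multiplication by a doubly stochastic matrix, so that nonexpansiveness and
  invariance of \<open>copies\<close> come from the general facts on
  \<open>kron_id_mult\<close>.\<close>

definition consensus :: "(real^'d)^'n \<Rightarrow> (real^'d)^('n::finite)" where
  "consensus v = kron_id_mult (\<chi> i j. 1 / real CARD('n)) v"

definition disagreement :: "(real^'d)^'n \<Rightarrow> real" where
  "disagreement v = norm (v - consensus v)"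

lemma doubly_stochastic_uniform: "doubly_stochastic (\<chi> i j. 1 / real CARD('n) :: real^'n^'n)"
  by (simp add: doubly_stochastic_def)

lemma norm_consensus_le: "norm (consensus v) \<le> norm v"
  unfolding consensus_def by (intro norm_kron_id_mult_le doubly_stochastic_uniform)

lemma consensus_mem_copies:
  fixes X :: "(real^'d) set"
  shows "convex X \<Longrightarrow> v \<in> copies X \<Longrightarrow> consensus v \<in> copies X"
  unfolding consensus_def by (intro kron_id_mult_mem_copies doubly_stochastic_uniform)

lemma consensus_const: "consensus (\<chi> i. a) = (\<chi> i. a)"
  by (simp add: consensus_def kron_id_mult_def vec_eq_iff sum_constant_scaleR del: sum_constant)

lemma consensus_kron_id_mult:
  fixes P :: "real^'n^'n" and v :: "(real^'d)^'n"
  assumes "doubly_stochastic P"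
  shows "consensus (kron_id_mult P v) = consensus v"
proof -
  have "(\<Sum>i\<in>UNIV. kron_id_mult P v $ i $ k) = (\<Sum>i\<in>UNIV. v $ i $ k)" for k
    using doubly_stochastic_sum_eq[OF assms, of "\<chi> i. v $ i $ k"] by (simp add: kron_id_mult_component)
  then show ?thesis
    by (simp add: consensus_def vec_eq_iff kron_id_mult_def[of "\<chi> i j. 1 / _"] sum_divide_distrib[symmetric])
qed

lemma kron_id_mult_consensus:
  fixes P :: "real^'n^'n" and v :: "(real^'d)^'n"
  assumes "doubly_stochastic P"
  shows "kron_id_mult P (consensus v) = consensus v"
  using assms by (simp add: consensus_def kron_id_mult_def vec_eq_iff doubly_stochastic_def
      sum_distrib_right[symmetric])

lemma disagreement_power2_eq:
  fixes v :: "(real^'d)^'n"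
  shows "(disagreement v)\<^sup>2 = (\<Sum>k\<in>UNIV. variance (\<chi> i. v $ i $ k))"
  by (simp add: disagreement_def norm_power2_stacked variance_def consensus_def kron_id_mult_def
      sum_divide_distrib)

lemma disagreement_nonneg: "0 \<le> disagreement v"
  by (simp add: disagreement_def)

lemma disagreement_le_norm:
  fixes v :: "(real^'d)^'n"
  shows "disagreement v \<le> norm v"
proof -
  have "variance (\<chi> i. v $ i $ k) \<le> (\<Sum>i\<in>UNIV. (v $ i $ k)\<^sup>2)" for k
    using variance_le_sum_power2_diff[of "\<chi> i. v $ i $ k" 0] by simp
  then have "(disagreement v)\<^sup>2 \<le> (norm v)\<^sup>2"
    unfolding norm_power2_stacked disagreement_power2_eq by (rule sum_mono)
  then show ?thesis by (rule power2_le_imp_le) simp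
qed

lemma disagreement_add_le: "disagreement (u + v) \<le> disagreement u + disagreement v"
proof -
  have "u + v - consensus (u + v) = (u - consensus u) + (v - consensus v)"
    by (simp add: consensus_def kron_id_mult_linear)
  then show ?thesis unfolding disagreement_def by (metis norm_triangle_ineq)
qed

lemma disagreement_scaleR: "disagreement (a *\<^sub>R v) = \<bar>a\<bar> * disagreement v"
  unfolding disagreement_def consensus_def kron_id_mult_linear scaleR_diff_right[symmetric] by simp

lemma disagreement_zero: "disagreement 0 = 0"
  using disagreement_scaleR[of 0 0] by simp

lemma disagreement_sum_le: "disagreement (\<Sum>s\<in>A. f s) \<le> (\<Sum>s\<in>A. disagreement (f s))"
proof (induction A rule: infinite_finite_induct)
  case (insert a A)
  then show ?case
    using disagreement_add_le[of "f a" "\<Sum>s\<in>A. f s"] by simp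
qed (simp_all add: disagreement_zero)

lemma disagreement_kron_id_mult_le:
  assumes "doubly_stochastic P"
  shows "disagreement (kron_id_mult P v) \<le> disagreement v"
proof -
  have "kron_id_mult P v - consensus (kron_id_mult P v) = kron_id_mult P (v - consensus v)"
    using assms by (simp add: consensus_kron_id_mult kron_id_mult_linear kron_id_mult_consensus)
  then show ?thesis
    unfolding disagreement_def using norm_kron_id_mult_le[OF assms] by metis
qed

text \<open>\<open>P\<close> fixes the consensus part, so only the remainder moves, and
  \<open>P\<close> does not enlarge it.\<close>

lemma norm_diff_kron_id_mult_le:
  assumes "doubly_stochastic P"
  shows "norm (v - kron_id_mult P v) \<le> 2 * disagreement v"
proof -
  have "v - kron_id_mult P v = (v - consensus v) - kron_id_mult P (v - consensus v)"
    using assms by (simp add: kron_id_mult_linear kron_id_mult_consensus)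
  then have "norm (v - kron_id_mult P v) \<le> norm (v - consensus v) + norm (kron_id_mult P (v - consensus v))"
    by (metis norm_triangle_ineq4)
  then show ?thesis
    using norm_kron_id_mult_le[OF assms, of "v - consensus v"] by (simp add: disagreement_def)
qed

section \<open>Accumulated disagreement under time-varying averaging\<close>

primrec evolve :: "(nat \<Rightarrow> real^'n^'n) \<Rightarrow> nat \<Rightarrow> nat \<Rightarrow> (real^'d)^'n \<Rightarrow> (real^'d)^('n::finite)" where
  "evolve P s 0 v = v"
| "evolve P s (Suc n) v = kron_id_mult (P (s + n)) (evolve P s n v)"

lemma evolve_add_steps: "evolve P s (m + n) v = evolve P (s + m) n (evolve P s m v)"
  by (induction n) (simp_all add: add.assoc)

lemma evolve_add: "evolve P s n (u + v) = evolve P s n u + evolve P s n v"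
  by (induction n) (simp_all add: kron_id_mult_linear)

definition total_disagreement :: "(nat \<Rightarrow> real^'n^'n) \<Rightarrow> nat \<Rightarrow> nat \<Rightarrow> (real^'d)^('n::finite) \<Rightarrow> real" where
  "total_disagreement P s n v = (\<Sum>j<n. disagreement (evolve P s j v))"

lemma total_disagreement_add_steps:
  "total_disagreement P s (m + n) v
    = total_disagreement P s m v + total_disagreement P (s + m) n (evolve P s m v)"
  by (induction n) (simp_all add: total_disagreement_def evolve_add_steps)

lemma total_disagreement_add_le:
  "total_disagreement P s n (u + v) \<le> total_disagreement P s n u + total_disagreement P s n v"
  unfolding total_disagreement_def sum.distrib[symmetric] evolve_add
  by (intro sum_mono disagreement_add_le)

locale averaging_network =
  fixes P :: "nat \<Rightarrow> real^'n^'n" and b :: nat and c :: real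
  assumes b: "b \<ge> 1" and c: "c > 0"
    and stoch: "\<And>t. t \<ge> 1 \<Longrightarrow> doubly_stochastic (P t)"
    and diag: "\<And>t i. t \<ge> 1 \<Longrightarrow> P t $ i $ i \<ge> c"
    and off: "\<And>t i j. t \<ge> 1 \<Longrightarrow> P t $ i $ j > 0 \<Longrightarrow> P t $ i $ j \<ge> c"
    and cross: "\<And>k S. k \<ge> 1 \<Longrightarrow> S \<noteq> {} \<Longrightarrow> S \<noteq> UNIV \<Longrightarrow> \<exists>t<b. crosses (P (k * b + t)) S"
begin

definition rate :: real where "rate = c / (4 * (real CARD('n))\<^sup>2)"

lemma c_le_1: "c \<le> 1"
proof -
  fix i :: 'n
  have "P 1 $ i $ i \<le> (\<Sum>j\<in>UNIV. P 1 $ i $ j)"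
    using stoch[of 1] by (intro member_le_sum) (auto simp: doubly_stochastic_def)
  then show ?thesis using stoch[of 1] diag[of 1 i] by (simp add: doubly_stochastic_def)
qed

lemma card_power2_ge_1: "1 \<le> (real CARD('n))\<^sup>2"
proof -
  have "1 \<le> real CARD('n)"
    using zero_less_card_finite[where 'a='n] by linarith
  then show ?thesis by simp
qed

lemma rate: "0 < rate" "rate < 1"
proof -
  show "0 < rate" using c by (simp add: rate_def)
  have "c < 4 * (real CARD('n))\<^sup>2" using c_le_1 card_power2_ge_1 by linarith
  then show "rate < 1" by (simp add: rate_def)
qed

lemma disagreement_evolve_le:
  assumes "s \<ge> 1"
  shows "disagreement (evolve P s n v) \<le> disagreement v"
proof (induction n)
  case (Suc n)
  have "disagreement (evolve P s (Suc n) v) \<le> disagreement (evolve P s n v)"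
    using assms by (simp add: disagreement_kron_id_mult_le stoch)
  then show ?case using Suc.IH by linarith
qed simp

text \<open>The squared disagreement shrinks by \<open>1 - 2 * rate\<close>, which is at most
  \<open>(1 - rate)^2\<close>. Taking the root halves the rate, whence the 4 in its
  denominator.\<close>

lemma disagreement_window_le:
  assumes k: "k \<ge> 1"
  shows "disagreement (evolve P (k * b) b v) \<le> (1 - rate) * disagreement v"
proof -
  have t: "k * b + t \<ge> 1" for t
    using k b by (simp add: Suc_le_eq)
  have "variance (\<chi> i. evolve P (k * b) b v $ i $ l) \<le> (1 - 2 * rate) * variance (\<chi> i. v $ i $ l)" for l
  proof -
    have "variance ((\<lambda>t. \<chi> i. evolve P (k * b) t v $ i $ l) b) \<le> (1 - c / (2 * (real CARD('n))\<^sup>2))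
        * variance ((\<lambda>t. \<chi> i. evolve P (k * b) t v $ i $ l) 0)"
      by (rule variance_contraction[where P = "\<lambda>t. P (k * b + t)"])
        (use t stoch diag off c cross[OF k] in \<open>auto simp: kron_id_mult_component vec_eq_iff\<close>)
    then show ?thesis by (simp add: rate_def)
  qed
  then have "(disagreement (evolve P (k * b) b v))\<^sup>2 \<le> (1 - 2 * rate) * (disagreement v)\<^sup>2"
    unfolding disagreement_power2_eq sum_distrib_left by (rule sum_mono)
  also have "\<dots> \<le> ((1 - rate) * disagreement v)\<^sup>2"
    unfolding power_mult_distrib by (intro mult_right_mono) (auto simp: power2_diff)
  finally show ?thesis
    by (rule power2_le_imp_le) (use rate in \<open>simp add: disagreement_nonneg\<close>)
qed

lemma total_disagreement_le_steps:
  assumes "s \<ge> 1"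
  shows "total_disagreement P s n v \<le> real n * disagreement v"
  unfolding total_disagreement_def
  using sum_mono[of "{..<n}" "\<lambda>j. disagreement (evolve P s j v)" "\<lambda>_. disagreement v",
      OF disagreement_evolve_le[OF assms]] by simp

text \<open>A geometric series summed by its fixed point:
  \<open>b + (b / rate) * (1 - rate) = b / rate\<close>. The induction removes a whole window at a
  time and is therefore strong.\<close>

lemma total_disagreement_aligned_le:
  "k \<ge> 1 \<Longrightarrow> total_disagreement P (k * b) n v \<le> real b / rate * disagreement v"
proof (induction n arbitrary: k v rule: less_induct)
  case (less n)
  have kb: "k * b \<ge> 1" using less.prems b by (simp add: Suc_le_eq)
  show ?case
  proof (cases "n \<le> b")
    case True
    have "total_disagreement P (k * b) n v \<le> real n * disagreement v"
      by (rule total_disagreement_le_steps[OF kb])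
    also have "\<dots> \<le> real b / rate * disagreement v"
    proof (intro mult_right_mono disagreement_nonneg)
      have "real b * rate \<le> real b" using rate by (simp add: mult_left_le)
      then have "real b \<le> real b / rate" using rate by (simp add: pos_le_divide_eq)
      then show "real n \<le> real b / rate" using True by linarith
    qed
    finally show ?thesis .
  next
    case False
    let ?v = "evolve P (k * b) b v"
    have "total_disagreement P (k * b) n v
        = total_disagreement P (k * b) b v + total_disagreement P ((k + 1) * b) (n - b) ?v"
      using total_disagreement_add_steps[of P "k * b" b "n - b" v] False by (simp add: add.commute)
    also have "\<dots> \<le> real b * disagreement v + real b / rate * disagreement ?v"
      using False b by (intro add_mono total_disagreement_le_steps kb less.IH) auto
    also have "\<dots> \<le> real b * disagreement v + real b / rate * ((1 - rate) * disagreement v)"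
      using disagreement_window_le[OF less.prems, of v] rate
      by (intro add_left_mono mult_left_mono) auto
    also have "\<dots> = real b / rate * disagreement v"
      using rate by (simp add: field_simps)
    finally show ?thesis .
  qed
qed

text \<open>Connectivity is given only on windows that start at multiples of \<open>b\<close>. The
  first summand pays for the wait until the next such start, the second for everything after
  it.\<close>

definition gain :: real where "gain = real b + real b / rate"

lemma gain_nonneg: "0 \<le> gain"
  using rate by (simp add: gain_def)

lemma total_disagreement_le:
  assumes s: "s \<ge> 1"
  shows "total_disagreement P s n v \<le> gain * disagreement v"
proof -
  \<comment> \<open>\<open>k * b\<close> is \<open>s\<close> rounded up to a multiple of
    \<open>b\<close>.\<close>
  define k where "k = (s + b - 1) div b"
  define m where "m = k * b - s"
  have kb: "k * b \<ge> s" "k * b \<le> s + b"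
  proof -
    have "s + b - 1 = k * b + (s + b - 1) mod b" unfolding k_def by simp
    moreover have "(s + b - 1) mod b < b" using b by simp
    ultimately show "k * b \<ge> s" "k * b \<le> s + b" by linarith+
  qed
  have k: "k \<ge> 1" using kb s by (cases k) auto
  have sm: "s + m = k * b" "m \<le> b" using kb by (auto simp: m_def)
  have "total_disagreement P s n v \<le> total_disagreement P s (m + n) v"
    unfolding total_disagreement_def by (intro sum_mono2) (auto simp: disagreement_nonneg)
  also have "\<dots> = total_disagreement P s m v + total_disagreement P (k * b) n (evolve P s m v)"
    by (simp add: total_disagreement_add_steps sm)
  also have "\<dots> \<le> real m * disagreement v + real b / rate * disagreement (evolve P s m v)"
    by (intro add_mono total_disagreement_le_steps s total_disagreement_aligned_le k)
  also have "\<dots> \<le> real b * disagreement v + real b / rate * disagreement v"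
    using sm rate disagreement_evolve_le[OF s] disagreement_nonneg
    by (intro add_mono mult_right_mono mult_left_mono) auto
  finally show ?thesis by (simp add: gain_def algebra_simps)
qed

text \<open>The inputs \<open>y (Suc t) - P t y t\<close> act as restarts of the homogeneous evolution.\<close>

lemma sum_disagreement_le_total:
  fixes y :: "nat \<Rightarrow> (real^'d)^'n"
  assumes "s \<ge> 1"
  shows "(\<Sum>j<n. disagreement (y (s + j))) \<le> total_disagreement P s n (y s)
    + gain * (\<Sum>j<n. norm (y (Suc (s + j)) - kron_id_mult (P (s + j)) (y (s + j))))"
  using assms
proof (induction n arbitrary: s)
  case 0
  then show ?case by (simp add: total_disagreement_def)
next
  case (Suc n)
  let ?u = "\<lambda>j. norm (y (Suc (s + j)) - kron_id_mult (P (s + j)) (y (s + j)))"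
  define u where "u = y (Suc s) - kron_id_mult (P s) (y s)"
  have "total_disagreement P (Suc s) n (y (Suc s))
      \<le> total_disagreement P (Suc s) n (kron_id_mult (P s) (y s)) + total_disagreement P (Suc s) n u"
    using total_disagreement_add_le[of P "Suc s" n "kron_id_mult (P s) (y s)" u] by (simp add: u_def)
  also have "total_disagreement P (Suc s) n u \<le> gain * norm u"
    using total_disagreement_le[of "Suc s" n u] mult_left_mono[OF disagreement_le_norm[of u] gain_nonneg]
    by linarith
  finally have "(\<Sum>j<Suc n. disagreement (y (s + j))) \<le> disagreement (y s)
      + (total_disagreement P (Suc s) n (kron_id_mult (P s) (y s)) + gain * norm u)
      + gain * (\<Sum>j<n. ?u (Suc j))"
    using Suc.IH[of "Suc s"] by (simp add: sum.lessThan_Suc_shift del: sum.lessThan_Suc)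
  moreover have "total_disagreement P s (Suc n) (y s)
      = disagreement (y s) + total_disagreement P (Suc s) n (kron_id_mult (P s) (y s))"
    using total_disagreement_add_steps[of P s 1 n "y s"] by (simp add: total_disagreement_def)
  moreover have "(\<Sum>j<Suc n. ?u j) = norm u + (\<Sum>j<n. ?u (Suc j))"
    by (simp add: sum.lessThan_Suc_shift u_def del: sum.lessThan_Suc)
  ultimately show ?case by (simp add: distrib_left del: sum.lessThan_Suc)
qed

end

section \<open>Projected subgradient steps with the doubling trick\<close>

text \<open>With \<open>y = 1 - (1 - h) powr (1 / b)\<close> the right-hand side is
  \<open>4 / (3 * y)\<close>, so an upper bound on \<open>y\<close> is needed. It comes from
  \<open>(1 + b * y) * (1 - y)^b <= (1 - y^2)^b <= 1\<close>, that is,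
  \<open>b * y * (1 - h) <= h\<close>.\<close>

lemma C_u_ge:
  assumes h: "0 < c" "c \<le> 1" and N: "2 \<le> N" and b: "b \<ge> 1"
  defines "h \<equiv> c / (4 * (real N)\<^sup>2)"
  shows "real b + real b / h \<le> 3 / 8 * C_u c N b"
proof -
  have "2\<^sup>2 \<le> (real N)\<^sup>2"
    using N by (intro power_mono) auto
  then have "16 * c \<le> 4 * (real N)\<^sup>2"
    using h by simp
  then have h16: "0 < h" "h \<le> 1 / 16"
    using h N by (auto simp: h_def field_simps)
  define y where "y = 1 - (1 - h) powr (1 / real b)"
  have pow: "(1 - y) ^ b = 1 - h"
    using h16 b by (simp add: y_def powr_realpow'[symmetric] powr_powr)
  have "(1 - h) powr (1 / real b) < 1"
    using h16 b powr_less_mono2[of "1 / real b" "1 - h" 1] by simp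
  moreover have "(1 - h) powr (1 / real b) > 0"
    using h16 by simp
  ultimately have y: "0 < y" "y < 1"
    by (auto simp: y_def)
  have "1 + real b * y \<le> (1 + y) ^ b"
    using Bernoulli_inequality[of y b] y by simp
  then have "(1 + real b * y) * (1 - y) ^ b \<le> (1 + y) ^ b * (1 - y) ^ b"
    using y by (intro mult_right_mono) auto
  also have "\<dots> = (1 - y\<^sup>2) ^ b"
    by (simp add: power_mult_distrib[symmetric] power2_eq_square algebra_simps)
  also have "\<dots> \<le> 1"
    using y by (intro power_le_one) (auto simp: power2_eq_square mult_le_one)
  finally have byh: "real b * y * (1 - h) \<le> h"
    using pow by (simp add: algebra_simps)
  have "(real b + real b / h) * y = real b * y * (1 + h) / h"
    using h16 by (simp add: field_simps)
  \<comment> \<open>This comparison requires \<open>h <= 1 / 7\<close>; two agents already give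
    \<open>h <= 1 / 16\<close>.\<close>
  also have "\<dots> \<le> real b * y * (4 / 3 * (1 - h)) / h"
    using h16 y by (intro divide_right_mono mult_left_mono) auto
  also have "\<dots> = 4 / 3 * (real b * y * (1 - h)) / h"
    by simp
  also have "\<dots> \<le> 4 / 3 * h / h"
    using byh h16 by (intro divide_right_mono mult_left_mono) auto
  finally have "(real b + real b / h) * y \<le> 4 / 3"
    using h16 by simp
  then have "real b + real b / h \<le> 4 / 3 / y"
    using pos_le_divide_eq[OF y(1), of "real b + real b / h" "4 / 3"] by blast
  also have "\<dots> = 3 / 8 * C_u c N b"
    unfolding C_u_def h_def[symmetric] y_def[symmetric] by simp
  finally show ?thesis .
qed

lemma C_u_nonneg:
  assumes "0 < c" "c \<le> 1" "1 \<le> N"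
  shows "0 \<le> C_u c N b"
proof -
  have "1 \<le> (real N)\<^sup>2"
    using assms(3) by simp
  then have "c \<le> 4 * (real N)\<^sup>2" "0 < (real N)\<^sup>2"
    using assms(2) by linarith+
  then have h: "0 \<le> c / (4 * (real N)\<^sup>2)" "c / (4 * (real N)\<^sup>2) \<le> 1"
    using assms(1) by (auto simp: divide_le_eq)
  then have "(1 - c / (4 * (real N)\<^sup>2)) powr (1 / real b) \<le> 1 powr (1 / real b)"
    by (intro powr_mono2) auto
  then show ?thesis
    by (simp add: C_u_def)
qed

text \<open>The limit of the ratio between the sum of \<open>sqrt 2 ^ l\<close> over
  \<open>l <= m\<close> and its last term.\<close>

definition doubling_const :: real where "doubling_const = sqrt 2 / (sqrt 2 - 1)"

lemma doubling_const_pos: "0 < doubling_const"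
  by (simp add: doubling_const_def)

text \<open>The horizon may fall inside an epoch, so the hypothesis covers truncated epochs and the
  last one is charged at its full price. The prices grow geometrically, hence the last one dominates
  up to \<open>doubling_const\<close>.\<close>

lemma sum_doubling_le:
  fixes a :: "nat \<Rightarrow> real"
  assumes epoch: "\<And>m T. T \<le> 2 ^ m \<Longrightarrow> (\<Sum>j<T. a (2 ^ m + j)) \<le> K * sqrt (2 ^ m)"
    and K: "0 \<le> K" and n: "n \<ge> 1"
  shows "(\<Sum>s=1..n. a s) \<le> doubling_const * K * sqrt (real n)"
proof -
  obtain m where m: "2 ^ m \<le> n" "n < 2 ^ (m + 1)"
    using ex_power_ivl1[of 2 n] n by auto
  have shift: "(\<Sum>j<T. a (l + j)) = sum a {l..<l + T}" for l T
    using sum.shift_bounds_nat_ivl[of a 0 l T] by (simp add: atLeast0LessThan add.commute)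
  have prefix: "sum a {1..<2 ^ m} \<le> K * (\<Sum>l<m. sqrt 2 ^ l)" for m
  proof (induction m)
    case (Suc m)
    have "sum a {1..<2 ^ Suc m} = sum a {1..<2 ^ m} + sum a {2 ^ m..<2 ^ m + 2 ^ m}"
      by (subst sum.atLeastLessThan_concat) (auto simp: mult_2)
    also have "\<dots> \<le> K * (\<Sum>l<m. sqrt 2 ^ l) + K * sqrt (2 ^ m)"
      using Suc.IH epoch[of "2 ^ m" m] unfolding shift by simp
    also have "\<dots> = K * (\<Sum>l<Suc m. sqrt 2 ^ l)"
      by (simp add: real_sqrt_power algebra_simps)
    finally show ?case .
  qed simp
  have "(\<Sum>s=1..n. a s) = sum a {1..<2 ^ m} + sum a {2 ^ m..<2 ^ m + (Suc n - 2 ^ m)}"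
    using m by (subst sum.atLeastLessThan_concat) (auto simp: atLeastLessThanSuc_atLeastAtMost)
  also have "\<dots> \<le> K * (\<Sum>l<m. sqrt 2 ^ l) + K * sqrt (2 ^ m)"
  proof (rule add_mono[OF prefix])
    have "Suc n - 2 ^ m \<le> 2 ^ m" using m by simp
    then show "sum a {2 ^ m..<2 ^ m + (Suc n - 2 ^ m)} \<le> K * sqrt (2 ^ m)"
      using epoch[of "Suc n - 2 ^ m" m] unfolding shift by simp
  qed
  also have "\<dots> = K * (\<Sum>l<Suc m. sqrt 2 ^ l)"
    by (simp add: real_sqrt_power algebra_simps)
  also have "\<dots> = K * ((sqrt 2 ^ Suc m - 1) / (sqrt 2 - 1))"
    using geometric_sum[of "sqrt 2" "Suc m"] by simp
  also have "\<dots> \<le> K * (doubling_const * sqrt 2 ^ m)"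
    unfolding doubling_const_def using K
    by (intro mult_left_mono) (auto simp: divide_right_mono)
  also have "\<dots> = K * doubling_const * sqrt (real (2 ^ m))"
    by (simp add: real_sqrt_power)
  also have "\<dots> \<le> K * doubling_const * sqrt (real n)"
    using m(1) K doubling_const_pos by (intro mult_left_mono real_sqrt_le_mono of_nat_mono) auto
  finally show ?thesis by (simp add: mult.commute)
qed

lemma doubling_trick_epoch:
  "doubling_trick \<eta> \<Longrightarrow> j < 2 ^ m \<Longrightarrow> \<eta> (2 ^ m + j) = 1 / sqrt (2 ^ m)"
  by (auto simp: doubling_trick_def)

lemma doubling_trick_le_1:
  assumes "doubling_trick \<eta>" "t \<ge> 1"
  shows "\<eta> t \<le> 1"
proof -
  obtain m where m: "2 ^ m \<le> t" "t < 2 ^ (m + 1)"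
    using ex_power_ivl1[of 2 t] assms(2) by auto
  then have "\<eta> t = 1 / sqrt (2 ^ m)"
    using doubling_trick_epoch[OF assms(1), of "t - 2 ^ m" m] by simp
  then show ?thesis by (simp add: divide_le_eq)
qed

section \<open>Projected steps and their regret\<close>

lemma closest_point_Times:
  fixes X :: "'a::euclidean_space set" and Y :: "'b::euclidean_space set"
  assumes "closed X" "convex X" "X \<noteq> {}" "closed Y" "convex Y" "Y \<noteq> {}"
  shows "closest_point (X \<times> Y) (x, y) = (closest_point X x, closest_point Y y)"
proof (rule closest_point_unique[symmetric])
  show "\<forall>z\<in>X \<times> Y. dist (x, y) (closest_point X x, closest_point Y y) \<le> dist (x, y) z"
    using closest_point_exists(2)[OF assms(1,3)] closest_point_exists(2)[OF assms(4,6)]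
    by (auto simp: dist_Pair_Pair intro!: add_mono power_mono)
qed (use assms in \<open>auto simp: closed_Times convex_Times closest_point_in_set\<close>)

text \<open>The projection fixes \<open>p\<close> and is nonexpansive, so the squared distance of
  the unprojected step can be expanded instead.\<close>

lemma projected_step_regret:
  fixes X :: "'a::euclidean_space set"
  assumes X: "closed X" "convex X" "p \<in> X" and y: "y = closest_point X (q - e *\<^sub>R g)"
  shows "2 * e * (g \<bullet> (q - p)) \<le> (norm (q - p))\<^sup>2 - (norm (y - p))\<^sup>2 + e\<^sup>2 * (norm g)\<^sup>2"
proof -
  have "norm (y - p) \<le> norm (q - e *\<^sub>R g - p)"
    using closest_point_lipschitz[OF X(2,1), of "q - e *\<^sub>R g" p] X(3)
    by (auto simp: y closest_point_self dist_norm)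
  then have "(norm (y - p))\<^sup>2 \<le> (norm ((q - p) - e *\<^sub>R g))\<^sup>2"
    by (intro power_mono) (auto simp: algebra_simps)
  also have "\<dots> = (norm (q - p))\<^sup>2 - 2 * e * (g \<bullet> (q - p)) + e\<^sup>2 * (norm g)\<^sup>2"
    unfolding power2_norm_eq_inner
    by (simp add: inner_diff_left inner_diff_right inner_commute power2_eq_square algebra_simps)
  finally show ?thesis by simp
qed

lemma projected_step_dist:
  fixes X :: "'a::euclidean_space set"
  assumes X: "closed X" "convex X" "q \<in> X"
  shows "norm (closest_point X (q - e *\<^sub>R g) - q) \<le> \<bar>e\<bar> * norm g"
  using closest_point_lipschitz[OF X(2,1), of "q - e *\<^sub>R g" q] X(3)
  by (auto simp: closest_point_self dist_norm)

text \<open>Here \<open>q t\<close> is the averaged state, or \<open>x t\<close> itself for a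
  component without averaging, and \<open>contr\<close> lets the distances telescope through it. The
  rate is constant within an epoch, so only the distance at the start of the epoch survives; it is
  bounded through \<open>R\<close>.\<close>

lemma doubling_regret:
  fixes X :: "'a::euclidean_space set" and x q g :: "nat \<Rightarrow> 'a"
  assumes X: "closed X" "convex X" "p \<in> X" and \<eta>: "doubling_trick \<eta>"
    and step: "\<And>t. t \<ge> 1 \<Longrightarrow> x (Suc t) = closest_point X (q t - \<eta> t *\<^sub>R g t)"
    and contr: "\<And>t. t \<ge> 1 \<Longrightarrow> norm (q t - p) \<le> norm (x t - p)"
    and R: "\<And>t. t \<ge> 1 \<Longrightarrow> norm (x t) \<le> R" and H: "\<And>t. t \<ge> 1 \<Longrightarrow> norm (g t) \<le> H"
    and n: "n \<ge> 1"
  shows "(\<Sum>s=1..n. g s \<bullet> (q s - p)) \<le> sqrt (real n) * (doubling_const / 2 * ((R + norm p)\<^sup>2 + H\<^sup>2))"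
proof -
  define K where "K = (R + norm p)\<^sup>2 + H\<^sup>2"
  have "(\<Sum>j<T. 2 * (g (2 ^ m + j) \<bullet> (q (2 ^ m + j) - p))) \<le> K * sqrt (2 ^ m)" if T: "T \<le> 2 ^ m" for m T
  proof -
    define e where "e = 1 / sqrt (2 ^ m)"
    let ?s = "2 ^ m :: nat"
    let ?a = "\<lambda>j. (norm (x (?s + j) - p))\<^sup>2"
    have le: "e * (2 * (g (?s + j) \<bullet> (q (?s + j) - p))) \<le> (?a j - ?a (Suc j)) + e\<^sup>2 * H\<^sup>2"
      if j: "j < T" for j
    proof -
      have t: "?s + j \<ge> 1" by (simp add: Suc_le_eq)
      have "x (Suc (?s + j)) = closest_point X (q (?s + j) - e *\<^sub>R g (?s + j))"
        using step[OF t] doubling_trick_epoch[OF \<eta>, of j m] j T by (simp add: e_def)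
      from projected_step_regret[OF X this]
      have "2 * e * (g (?s + j) \<bullet> (q (?s + j) - p))
          \<le> (norm (q (?s + j) - p))\<^sup>2 - ?a (Suc j) + e\<^sup>2 * (norm (g (?s + j)))\<^sup>2" by simp
      moreover have "(norm (q (?s + j) - p))\<^sup>2 \<le> ?a j"
        using contr[OF t] by (intro power_mono) auto
      moreover have "e\<^sup>2 * (norm (g (?s + j)))\<^sup>2 \<le> e\<^sup>2 * H\<^sup>2"
        using H[OF t] by (intro mult_left_mono power_mono) auto
      ultimately show ?thesis unfolding add_Suc_right by linarith
    qed
    have "e * (\<Sum>j<T. 2 * (g (?s + j) \<bullet> (q (?s + j) - p)))
        \<le> (\<Sum>j<T. (?a j - ?a (Suc j)) + e\<^sup>2 * H\<^sup>2)"
      unfolding sum_distrib_left by (intro sum_mono le) simp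
    also have "\<dots> = ?a 0 - ?a T + (real T * e\<^sup>2) * H\<^sup>2"
      using sum_lessThan_telescope'[of ?a T] by (simp add: sum.distrib)
    also have "\<dots> \<le> ?a 0 + 1 * H\<^sup>2"
    proof -
      have "real T \<le> 2 ^ m" using T by (metis of_nat_le_iff of_nat_numeral of_nat_power)
      then have "real T * e\<^sup>2 \<le> 1" by (simp add: e_def power_divide divide_le_eq)
      then have "(real T * e\<^sup>2) * H\<^sup>2 \<le> 1 * H\<^sup>2" by (intro mult_right_mono) auto
      then show ?thesis using zero_le_power2[of "norm (x (?s + T) - p)"] by linarith
    qed
    also have "?a 0 \<le> (R + norm p)\<^sup>2"
      using R[of ?s] norm_triangle_ineq4[of "x ?s" p] by (intro power_mono) auto
    finally have "e * (\<Sum>j<T. 2 * (g (?s + j) \<bullet> (q (?s + j) - p))) \<le> K"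
      by (simp add: K_def)
    then show ?thesis
      by (simp add: e_def field_simps)
  qed
  from sum_doubling_le[OF this _ n]
  have "2 * (\<Sum>s=1..n. g s \<bullet> (q s - p)) \<le> doubling_const * K * sqrt (real n)"
    by (simp add: K_def sum_distrib_left)
  then show ?thesis by (simp add: K_def algebra_simps)
qed

lemma time_avg_Suc: "time_avg x (Suc n) = (\<Sum>s=1..n. (1 / real n) *\<^sub>R x s)"
  by (simp add: time_avg_def scaleR_sum_right)

lemma time_avg_mem:
  assumes "convex X" "\<And>s. s \<ge> 1 \<Longrightarrow> x s \<in> X" "n \<ge> 1"
  shows "time_avg x (Suc n) \<in> X"
  unfolding time_avg_Suc using assms by (intro convex_sum) auto

lemma convex_on_time_avg_le:
  assumes "convex_on X f" "\<And>s. s \<ge> 1 \<Longrightarrow> x s \<in> X" "n \<ge> 1"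
  shows "f (time_avg x (Suc n)) \<le> (\<Sum>s=1..n. f (x s)) / real n"
proof -
  have "f (\<Sum>s=1..n. (1 / real n) *\<^sub>R x s) \<le> (\<Sum>s=1..n. (1 / real n) * f (x s))"
    using assms by (intro convex_on_sum) auto
  then show ?thesis by (simp add: time_avg_Suc sum_divide_distrib)
qed

lemma norm_time_avg_le:
  assumes "\<And>s. s \<ge> 1 \<Longrightarrow> norm (x s) \<le> R" "n \<ge> 1"
  shows "norm (time_avg x (Suc n)) \<le> R"
  using time_avg_mem[of "cball 0 R" x n] assms by simp

section \<open>Laplacian averaging\<close>

text \<open>Eigenvectors of \<open>transpose A ** A\<close> for distinct singular values are
  orthogonal, hence independent. Finiteness makes \<open>Max\<close> in \<open>sigma_max\<close> a
  genuine upper bound.\<close>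

lemma singular_values_finite: "finite (singular_values (A :: real^'n^'m))"
proof -
  let ?M = "transpose A ** A"
  have "\<forall>s\<in>singular_values A. \<exists>v. v \<noteq> 0 \<and> ?M *v v = s\<^sup>2 *\<^sub>R v"
    by (simp add: singular_values_def)
  then obtain v where v: "\<And>s. s \<in> singular_values A \<Longrightarrow> v s \<noteq> 0 \<and> ?M *v v s = s\<^sup>2 *\<^sub>R v s"
    using bchoice[of "singular_values A" "\<lambda>s v. v \<noteq> 0 \<and> ?M *v v = s\<^sup>2 *\<^sub>R v"] by blast
  have sym: "(?M *v x) \<bullet> y = x \<bullet> (?M *v y)" for x y
    by (metis dot_lmul_matrix matrix_transpose_mul transpose_matrix_vector transpose_transpose)
  have orth: "v s \<bullet> v r = 0" if "s \<in> singular_values A" "r \<in> singular_values A" "s \<noteq> r" for s r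
  proof -
    have "s\<^sup>2 * (v s \<bullet> v r) = r\<^sup>2 * (v s \<bullet> v r)"
      using sym[of "v s" "v r"] v that by simp
    moreover have "s\<^sup>2 \<noteq> r\<^sup>2"
      using that by (auto simp: singular_values_def power2_eq_iff)
    ultimately show ?thesis by simp
  qed
  have inj: "inj_on v (singular_values A)"
  proof (rule inj_onI, rule ccontr)
    fix s r assume "s \<in> singular_values A" "r \<in> singular_values A" "v s = v r" "s \<noteq> r"
    then show False using orth[of s r] v[of s] by simp
  qed
  have "pairwise orthogonal (v ` singular_values A)"
    using orth by (auto simp: pairwise_def orthogonal_def)
  moreover have "0 \<notin> v ` singular_values A"
    using v by auto
  ultimately have "finite (v ` singular_values A)"
    using pairwise_orthogonal_independent finiteI_independent by blast
  then show ?thesis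
    using inj finite_imageD by blast
qed

text \<open>The all-ones vector is in the kernel, so 0 is a singular value. The purpose is
  \<open>\<Lambda> >= 0\<close>, which permits enlarging 3 to
  \<open>3 + \<sigma> * \<Lambda>\<close>.\<close>

lemma sigma_max_laplacian_nonneg: "0 \<le> sigma_max (laplacian (A :: real^'n^'n))"
proof -
  have "laplacian A *v 1 = 0"
    by (simp add: laplacian_def vec_eq_iff matrix_vector_mult_def sum_subtractf)
  then have "(transpose (laplacian A) ** laplacian A) *v 1 = 0\<^sup>2 *\<^sub>R 1"
    by (simp add: matrix_vector_mul_assoc[symmetric])
  moreover have "(1 :: real^'n) \<noteq> 0"
    by simp
  ultimately have "0 \<in> singular_values (laplacian A)"
    unfolding singular_values_def by blast
  then show ?thesis
    unfolding sigma_max_def using singular_values_finite by (rule Max_ge[rotated])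
qed

definition averaging_matrix :: "real \<Rightarrow> real^'n^'n \<Rightarrow> real^'n^('n::finite)" where
  "averaging_matrix \<sigma> A = mat 1 - \<sigma> *\<^sub>R laplacian A"

lemma averaging_matrix_component:
  "averaging_matrix \<sigma> A $ i $ j = (if i = j then 1 - \<sigma> * (out_degree A i - A $ i $ i) else \<sigma> * A $ i $ j)"
  by (simp add: averaging_matrix_def laplacian_def mat_def out_degree_def matrix_vector_mult_def)

lemma kron_id_mult_averaging_matrix:
  "kron_id_mult (averaging_matrix \<sigma> A) v = v - \<sigma> *\<^sub>R kron_id_mult (laplacian A) v"
proof -
  have "(\<Sum>j\<in>UNIV. (if i = j then 1 else 0) *\<^sub>R v $ j) = v $ i" for i
    by (simp add: if_distrib[where f = "\<lambda>x. x *\<^sub>R _"] cong: if_cong)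
  then show ?thesis
    unfolding kron_id_mult_def averaging_matrix_def mat_def vec_eq_iff
    by (simp add: scaleR_diff_left sum_subtractf scaleR_sum_right)
qed

lemma doubly_stochastic_averaging_matrix:
  fixes A :: "real^'n^'n"
  assumes nn: "\<And>i j. 0 \<le> A $ i $ j" and bal: "weight_balanced A" and \<sigma>: "0 \<le> \<sigma>"
    and deg: "\<And>i. \<sigma> * out_degree A i \<le> 1"
  shows "doubly_stochastic (averaging_matrix \<sigma> A)"
  unfolding doubly_stochastic_def
proof (intro conjI allI)
  have split: "(\<Sum>j\<in>UNIV. if k = j then a else f j) = a - f k + (\<Sum>j\<in>UNIV. f j)" for k :: 'n and a :: real and f
    by (simp add: sum.remove[of UNIV k f] sum.remove[of UNIV k "\<lambda>j. if k = j then a else f j"])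
  fix i j
  have "\<sigma> * (out_degree A i - A $ i $ i) \<le> \<sigma> * out_degree A i"
    using nn \<sigma> by (intro mult_left_mono) auto
  then show "0 \<le> averaging_matrix \<sigma> A $ i $ j"
    using nn \<sigma> deg[of i] by (auto simp: averaging_matrix_component)
  show "(\<Sum>j\<in>UNIV. averaging_matrix \<sigma> A $ i $ j) = 1"
    unfolding averaging_matrix_component split
    by (simp add: out_degree_def sum_distrib_left algebra_simps)
  have "averaging_matrix \<sigma> A $ i $ j
      = (if j = i then 1 - \<sigma> * (out_degree A j - A $ j $ j) else \<sigma> * A $ i $ j)" for i
    by (auto simp: averaging_matrix_component)
  then have "(\<Sum>i\<in>UNIV. averaging_matrix \<sigma> A $ i $ j)
      = 1 - \<sigma> * (out_degree A j - A $ j $ j) - \<sigma> * A $ j $ j + (\<Sum>i\<in>UNIV. \<sigma> * A $ i $ j)"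
    by (simp only: split)
  also have "(\<Sum>i\<in>UNIV. \<sigma> * A $ i $ j) = \<sigma> * out_degree A j"
    using bal by (simp add: weight_balanced_def out_degree_def sum_distrib_left[symmetric])
  finally show "(\<Sum>i\<in>UNIV. averaging_matrix \<sigma> A $ i $ j) = 1"
    by (simp add: algebra_simps)
qed

text \<open>The two ends of the stepsize interval have separate roles: the lower one keeps positive
  off-diagonal weights at least \<open>c\<close>, the upper one leaves at least \<open>c\<close> on
  the diagonal.\<close>

lemma averaging_network_of_digraphs:
  fixes A :: "nat \<Rightarrow> real^'n^'n"
  assumes nonneg: "\<forall>t\<ge>1. \<forall>i j. 0 \<le> A t $ i $ j"
    and connected: "b \<ge> 1" "jointly_connected b A"
    and nondeg: "nondegenerate \<delta> A"
    and balanced: "\<forall>t\<ge>1. weight_balanced (A t)"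
    and \<sigma>: "0 < \<sigma>" and c: "0 < c" "c \<le> \<sigma> * \<delta>"
    and deg: "\<And>t i. t \<ge> 1 \<Longrightarrow> \<sigma> * out_degree (A t) i \<le> 1 - c"
  shows "averaging_network (\<lambda>t. averaging_matrix \<sigma> (A t)) b c"
proof
  show "b \<ge> 1" "c > 0" by fact+
  fix t :: nat and i j :: 'n assume t: "t \<ge> 1"
  show "doubly_stochastic (averaging_matrix \<sigma> (A t))"
  proof (rule doubly_stochastic_averaging_matrix)
    show "\<sigma> * out_degree (A t) i \<le> 1" for i using deg[OF t, of i] c(1) by linarith
  qed (use nonneg balanced \<sigma> t in auto)
  have "\<sigma> * (out_degree (A t) i - A t $ i $ i) \<le> \<sigma> * out_degree (A t) i"
    using nonneg \<sigma> t by (intro mult_left_mono) auto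
  then show diag: "c \<le> averaging_matrix \<sigma> (A t) $ i $ i"
    using deg[OF t, of i] by (simp add: averaging_matrix_component)
  assume pos: "averaging_matrix \<sigma> (A t) $ i $ j > 0"
  show "c \<le> averaging_matrix \<sigma> (A t) $ i $ j"
  proof (cases "i = j")
    case True
    then show ?thesis using diag by simp
  next
    case False
    then have "A t $ i $ j > 0"
      using pos \<sigma> by (simp add: averaging_matrix_component zero_less_mult_iff)
    then have "\<delta> \<le> A t $ i $ j"
      using nondeg t by (auto simp: nondegenerate_def intro: less_imp_le)
    then have "\<sigma> * \<delta> \<le> \<sigma> * A t $ i $ j"
      using \<sigma> by simp
    then show ?thesis using c False by (simp add: averaging_matrix_component)
  qed
next
  fix k :: nat and S :: "'n set"
  assume k: "k \<ge> 1" and S: "S \<noteq> {}" "S \<noteq> UNIV"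
  have "\<exists>t\<in>{k * b..(k + 1) * b - 1}. crosses (averaging_matrix \<sigma> (A t)) S"
  proof -
    obtain i j where "i \<in> S" "j \<notin> S" using S by blast
    moreover have "strongly_connected_edges (\<Union>t\<in>{k * b..(k + 1) * b - 1}. edges (A t))"
      using connected(2) k by (simp add: jointly_connected_def)
    ultimately show ?thesis
      using \<sigma> by (intro strongly_connected_edges_crosses[where E = "\<lambda>t. edges (A t)"])
        (auto simp: edges_def averaging_matrix_component)
  qed
  then obtain t where t: "k * b \<le> t" "t \<le> (k + 1) * b - 1" "crosses (averaging_matrix \<sigma> (A t)) S"
    by auto
  then have "t - k * b < b" "k * b + (t - k * b) = t"
    using connected(1) by (auto simp: algebra_simps)
  then show "\<exists>t<b. crosses (averaging_matrix \<sigma> (A (k * b + t))) S"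
    using t(3) by metis
qed

lemma copies_closed:
  fixes X :: "(real^'d) set"
  assumes "closed X" shows "closed (copies X :: ((real^'d)^'n) set)"
proof -
  have "copies X = (\<Inter>i. (\<lambda>x. x $ i) -` X :: ((real^'d)^'n) set)"
    by (auto simp: copies_def)
  then show ?thesis
    using assms by (auto intro!: closed_INT continuous_closed_vimage continuous_intros)
qed

lemma copies_convex:
  fixes X :: "(real^'d) set"
  assumes "convex X" shows "convex (copies X)"
  using assms by (auto simp: copies_def convex_def)

lemma disagreement_time_avg_le:
  "disagreement (time_avg y (Suc n)) \<le> (\<Sum>s=1..n. disagreement (y s)) / real n"
  unfolding time_avg_Suc
  using disagreement_sum_le[of "\<lambda>s. (1 / real n) *\<^sub>R y s" "{1..n}"]
  by (simp add: disagreement_scaleR sum_divide_distrib)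

section \<open>Disagreement and regret of a networked variable\<close>

locale consensus_player = averaging_network P b c
  for P :: "nat \<Rightarrow> real^'n^'n" and b c +
  fixes Y :: "(real^'d) set" and y h :: "nat \<Rightarrow> (real^'d)^'n" and \<eta> :: "nat \<Rightarrow> real" and R H :: real
  assumes Y: "closed Y" "convex Y" and \<eta>: "doubling_trick \<eta>"
    and mem: "\<And>t. t \<ge> 1 \<Longrightarrow> y t \<in> copies Y"
    and step: "\<And>t. t \<ge> 1 \<Longrightarrow> y (Suc t) = closest_point (copies Y) (kron_id_mult (P t) (y t) - \<eta> t *\<^sub>R h t)"
    and R: "\<And>t. t \<ge> 1 \<Longrightarrow> norm (y t) \<le> R" and H: "\<And>t. t \<ge> 1 \<Longrightarrow> norm (h t) \<le> H"
begin

text \<open>For two or more agents this dominates \<open>gain * (R + H)\<close>: the disagreement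
  summed over an epoch, relative to the root of its length.\<close>

definition gap :: real where "gap = 3 / 8 * C_u c CARD('n) b * (R + H)"

lemma R_nonneg: "0 \<le> R" and H_nonneg: "0 \<le> H"
  using R[of 1] H[of 1] norm_ge_zero[of "y 1"] norm_ge_zero[of "h 1"] by linarith+

lemma gap_nonneg: "0 \<le> gap"
  unfolding gap_def
  by (intro mult_nonneg_nonneg C_u_nonneg c c_le_1 add_nonneg_nonneg R_nonneg H_nonneg) simp_all

lemma sum_disagreement_le:
  assumes n: "n \<ge> 1"
  shows "(\<Sum>s=1..n. disagreement (y s)) \<le> sqrt (real n) * (doubling_const * gap)"
proof (cases "CARD('n) = 1")
  \<comment> \<open>A single agent is always in consensus. It is treated apart because the
    comparison of \<open>gain\<close> with \<open>C_u\<close> needs at least two agents.\<close>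
  case True
  then have U: "(UNIV :: 'n set) = {i}" for i
    by (metis UNIV_I card_1_singletonE singletonD)
  have "consensus v $ i = v $ i" for v :: "(real^'d)^'n" and i
    by (simp add: consensus_def kron_id_mult_def U[of i])
  then have "consensus v = v" for v :: "(real^'d)^'n"
    unfolding vec_eq_iff[of "consensus v" v] by blast
  then have "disagreement (y s) = 0" for s
    by (simp add: disagreement_def)
  then show ?thesis
    using gap_nonneg doubling_const_pos by simp
next
  case False
  moreover have "CARD('n) \<ge> 1" by (simp add: Suc_le_eq)
  ultimately have "2 \<le> CARD('n)" by linarith
  then have gain: "gain \<le> 3 / 8 * C_u c CARD('n) b"
    unfolding gain_def rate_def using C_u_ge[OF c c_le_1 _ b] by blast
  have "(\<Sum>j<T. disagreement (y (2 ^ m + j))) \<le> gap * sqrt (2 ^ m)" if T: "T \<le> 2 ^ m" for m T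
  proof -
    let ?s = "2 ^ m :: nat"
    have s: "?s \<ge> 1" by simp
    \<comment> \<open>The averaged state lies in the convex constraint set and is fixed by the
      projection, so projecting the step cannot increase its distance from that state.\<close>
    have u: "norm (y (Suc (?s + j)) - kron_id_mult (P (?s + j)) (y (?s + j))) \<le> H / sqrt (2 ^ m)"
      if j: "j < T" for j
    proof -
      have t: "?s + j \<ge> 1" by (simp add: Suc_le_eq)
      have "norm (y (Suc (?s + j)) - kron_id_mult (P (?s + j)) (y (?s + j))) \<le> \<bar>\<eta> (?s + j)\<bar> * norm (h (?s + j))"
        unfolding step[OF t] using Y
        by (intro projected_step_dist copies_closed copies_convex kron_id_mult_mem_copies stoch mem t)
      also have "\<dots> = norm (h (?s + j)) / sqrt (2 ^ m)"
        using doubling_trick_epoch[OF \<eta>, of j m] j T by simp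
      also have "\<dots> \<le> H / sqrt (2 ^ m)"
        using H[OF t] by (intro divide_right_mono) auto
      finally show ?thesis .
    qed
    have T': "real T \<le> 2 ^ m"
      using T by (metis of_nat_le_iff of_nat_numeral of_nat_power)
    have "(\<Sum>j<T. norm (y (Suc (?s + j)) - kron_id_mult (P (?s + j)) (y (?s + j)))) \<le> (\<Sum>j<T. H / sqrt (2 ^ m))"
      by (intro sum_mono u) simp
    also have "\<dots> = real T * H / sqrt (2 ^ m)" by simp
    also have "\<dots> \<le> 2 ^ m * H / sqrt (2 ^ m)"
      using T' H_nonneg by (intro divide_right_mono mult_right_mono) auto
    also have "\<dots> = H * sqrt (2 ^ m)"
      by (simp add: divide_eq_eq)
    finally have inputs: "(\<Sum>j<T. norm (y (Suc (?s + j)) - kron_id_mult (P (?s + j)) (y (?s + j)))) \<le> H * sqrt (2 ^ m)" .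
    \<comment> \<open>The disagreement inherited from earlier epochs is bounded crudely by
      \<open>R\<close> and inflated to the order of the inputs.\<close>
    have "disagreement (y ?s) \<le> R"
      using disagreement_le_norm[of "y ?s"] R[OF s] by linarith
    also have "\<dots> \<le> R * sqrt (2 ^ m)"
      using mult_left_mono[of 1 "sqrt (2 ^ m)" R] R_nonneg by simp
    finally have "total_disagreement P ?s T (y ?s) \<le> gain * (R * sqrt (2 ^ m))"
      using total_disagreement_le[OF s, of T "y ?s"] gain_nonneg mult_left_mono order_trans by blast
    moreover have "gain * (\<Sum>j<T. norm (y (Suc (?s + j)) - kron_id_mult (P (?s + j)) (y (?s + j))))
        \<le> gain * (H * sqrt (2 ^ m))"
      using inputs gain_nonneg by (rule mult_left_mono)
    ultimately have "(\<Sum>j<T. disagreement (y (?s + j))) \<le> gain * ((R + H) * sqrt (2 ^ m))"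
      using sum_disagreement_le_total[OF s, of y T] by (simp add: algebra_simps)
    also have "\<dots> \<le> (3 / 8 * C_u c CARD('n) b) * ((R + H) * sqrt (2 ^ m))"
      using gain R_nonneg H_nonneg by (intro mult_right_mono) auto
    finally show ?thesis by (simp add: gap_def mult.assoc)
  qed
  from sum_doubling_le[OF this gap_nonneg n] show ?thesis by (simp add: mult_ac)
qed

lemma disagreement_average_le:
  assumes "n \<ge> 1"
  shows "disagreement (time_avg y (Suc n)) \<le> doubling_const * gap / sqrt (real n)"
proof -
  have "disagreement (time_avg y (Suc n)) \<le> sqrt (real n) * (doubling_const * gap) / real n"
    using disagreement_time_avg_le[of y n] divide_right_mono[OF sum_disagreement_le[OF assms], of "real n"]
    by simp
  also have "\<dots> = doubling_const * gap / sqrt (real n)"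
    using assms by (simp add: field_simps)
  finally show ?thesis .
qed

text \<open>\<open>y s - p\<close> splits into three parts: \<open>?q s - consensus p\<close>, where
  the comparison point is fixed by averaging and \<open>doubling_regret\<close> applies;
  \<open>y s - ?q s\<close>, controlled by the disagreement of the iterate; and
  \<open>consensus p - p\<close>, which produces the linear term.\<close>

lemma regret:
  assumes n: "n \<ge> 1" and p: "p \<in> copies Y"
  shows "(\<Sum>s=1..n. h s \<bullet> (y s - p))
    \<le> sqrt (real n) * (doubling_const / 2 * ((R + norm p)\<^sup>2 + H\<^sup>2) + 2 * H * (doubling_const * gap))
      + real n * (H * disagreement p)"
proof -
  let ?q = "\<lambda>s. kron_id_mult (P s) (y s)"
  have cp: "consensus p \<in> copies Y"
    using Y p by (intro consensus_mem_copies)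
  have contr: "norm (?q t - consensus p) \<le> norm (y t - consensus p)" if "t \<ge> 1" for t
    using norm_kron_id_mult_le[OF stoch[OF that], of "y t - consensus p"]
    by (simp add: kron_id_mult_linear kron_id_mult_consensus[OF stoch[OF that]])
  have "(\<Sum>s=1..n. h s \<bullet> (?q s - consensus p))
      \<le> sqrt (real n) * (doubling_const / 2 * ((R + norm (consensus p))\<^sup>2 + H\<^sup>2))"
    by (rule doubling_regret[OF copies_closed copies_convex cp \<eta> step contr R H n]) (use Y in auto)
  also have "\<dots> \<le> sqrt (real n) * (doubling_const / 2 * ((R + norm p)\<^sup>2 + H\<^sup>2))"
    using norm_consensus_le[of p] R_nonneg doubling_const_pos
    by (intro mult_left_mono add_right_mono power_mono) auto
  finally have 1: "(\<Sum>s=1..n. h s \<bullet> (?q s - consensus p))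
      \<le> sqrt (real n) * (doubling_const / 2 * ((R + norm p)\<^sup>2 + H\<^sup>2))" .
  have "(\<Sum>s=1..n. h s \<bullet> (y s - ?q s)) \<le> (\<Sum>s=1..n. 2 * H * disagreement (y s))"
  proof (rule sum_mono)
    fix s assume "s \<in> {1..n}"
    then have s: "s \<ge> 1" by simp
    have "h s \<bullet> (y s - ?q s) \<le> norm (h s) * norm (y s - ?q s)"
      by (rule norm_cauchy_schwarz)
    also have "\<dots> \<le> H * (2 * disagreement (y s))"
      using H[OF s] norm_diff_kron_id_mult_le[OF stoch[OF s], of "y s"] H_nonneg
      by (intro mult_mono) auto
    finally show "h s \<bullet> (y s - ?q s) \<le> 2 * H * disagreement (y s)" by simp
  qed
  also have "\<dots> \<le> 2 * H * (sqrt (real n) * (doubling_const * gap))"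
    unfolding sum_distrib_left[symmetric] using sum_disagreement_le[OF n] H_nonneg
    by (intro mult_left_mono) auto
  finally have 2: "(\<Sum>s=1..n. h s \<bullet> (y s - ?q s)) \<le> sqrt (real n) * (2 * H * (doubling_const * gap))"
    by (simp add: mult_ac)
  have "(\<Sum>s=1..n. h s \<bullet> (consensus p - p)) \<le> (\<Sum>s=1..n. H * disagreement p)"
  proof (rule sum_mono)
    fix s assume "s \<in> {1..n}"
    then have "norm (h s) \<le> H" using H by simp
    then show "h s \<bullet> (consensus p - p) \<le> H * disagreement p"
      using norm_cauchy_schwarz[of "h s" "consensus p - p"]
        mult_right_mono[of "norm (h s)" H "norm (consensus p - p)"]
      by (simp add: disagreement_def norm_minus_commute)
  qed
  then have 3: "(\<Sum>s=1..n. h s \<bullet> (consensus p - p)) \<le> real n * (H * disagreement p)"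
    by simp
  have "(\<Sum>s=1..n. h s \<bullet> (y s - p)) = (\<Sum>s=1..n. h s \<bullet> (?q s - consensus p))
      + (\<Sum>s=1..n. h s \<bullet> (y s - ?q s)) + (\<Sum>s=1..n. h s \<bullet> (consensus p - p))"
    unfolding sum.distrib[symmetric] by (intro sum.cong refl) (simp add: inner_diff_right)
  then show ?thesis
    using 1 2 3 by (simp add: distrib_left)
qed

end

section \<open>Averages and the saddle gap\<close>

text \<open>
  Nothing bounds the norm of the comparison point \<open>p\<close>. Therefore the first player is compared with
  its own average at a later time \<open>r\<close>, and only that average is compared with \<open>p\<close>; the contribution
  of \<open>p\<close> vanishes as \<open>r\<close> tends to infinity. The price is that the second player's \<open>d\<^sub>2\<close> enters twice.
\<close>

lemma saddle_average_upper:
  fixes f :: "'a::real_inner \<Rightarrow> 'b::real_inner \<Rightarrow> real"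
  assumes convex: "\<And>y. y \<in> Y \<Longrightarrow> convex_on X (\<lambda>x. f x y)"
    and concave: "\<And>x. x \<in> X \<Longrightarrow> concave_on Y (\<lambda>y. f x y)"
    and sets: "convex X" "convex Y"
    and mem: "\<And>s. s \<ge> 1 \<Longrightarrow> x s \<in> X" "\<And>s. s \<ge> 1 \<Longrightarrow> y s \<in> Y"
    and sub: "\<And>s. s \<ge> 1 \<Longrightarrow> subgradient_on X (\<lambda>x'. f x' (y s)) (x s) (g s)"
    and super: "\<And>s. s \<ge> 1 \<Longrightarrow> subgradient_on Y (\<lambda>y'. - f (x s) y') (y s) (h s)"
    and regret1: "\<And>n q. n \<ge> 1 \<Longrightarrow> q \<in> X \<Longrightarrow>
      (\<Sum>s=1..n. g s \<bullet> (x s - q)) \<le> sqrt (real n) * F\<^sub>1 q + real n * d\<^sub>1 q"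
    and regret2: "\<And>n q. n \<ge> 1 \<Longrightarrow> q \<in> Y \<Longrightarrow>
      (\<Sum>s=1..n. h s \<bullet> (y s - q)) \<le> sqrt (real n) * F\<^sub>2 q + real n * d\<^sub>2 q"
    and F1: "\<And>n. n \<ge> 1 \<Longrightarrow> F\<^sub>1 (time_avg x (Suc n)) \<le> c\<^sub>1"
    and F2: "\<And>n. n \<ge> 1 \<Longrightarrow> F\<^sub>2 (time_avg y (Suc n)) \<le> c\<^sub>2"
    and d1: "\<And>n. n \<ge> 1 \<Longrightarrow> d\<^sub>1 (time_avg x (Suc n)) \<le> k\<^sub>1 / sqrt (real n)"
    and d2: "\<And>n. n \<ge> 1 \<Longrightarrow> d\<^sub>2 (time_avg y (Suc n)) \<le> k\<^sub>2 / sqrt (real n)"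
    and p: "p \<in> X" "d\<^sub>1 p = 0" "\<And>y. y \<in> Y \<Longrightarrow> f p y \<le> v"
    and n: "n \<ge> 1"
  shows "f (time_avg x (Suc n)) (time_avg y (Suc n)) - v \<le> (c\<^sub>1 + c\<^sub>2 + 2 * k\<^sub>2) / sqrt (real n)"
proof -
  define val where "val m = (\<Sum>s=1..m. f (x s) (y s)) / real m" for m
  have scale: "(sqrt (real m) * a + real m * e) / real m = a / sqrt (real m) + e" if "m \<ge> 1" for m a e
  proof -
    have "sqrt (real m) * a / real m = a / sqrt (real m)"
      using that by (simp add: field_simps)
    then show ?thesis using that by (simp add: add_divide_distrib)
  qed
  have upper: "val m \<le> f q (time_avg y (Suc m)) + F\<^sub>1 q / sqrt (real m) + d\<^sub>1 q"
    if m: "m \<ge> 1" and q: "q \<in> X" for m q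
  proof -
    have "f (x s) (y s) \<le> f q (y s) + g s \<bullet> (x s - q)" if "s \<in> {1..m}" for s
      using sub[of s] that q by (auto simp: subgradient_on_def inner_diff_right algebra_simps)
    then have "val m \<le> ((\<Sum>s=1..m. f q (y s)) + (\<Sum>s=1..m. g s \<bullet> (x s - q))) / real m"
      unfolding val_def sum.distrib[symmetric] by (intro divide_right_mono sum_mono) auto
    also have "\<dots> \<le> f q (time_avg y (Suc m)) + (sqrt (real m) * F\<^sub>1 q + real m * d\<^sub>1 q) / real m"
      unfolding add_divide_distrib[of "sum _ _"]
    proof (rule add_mono)
      show "(\<Sum>s=1..m. f q (y s)) / real m \<le> f q (time_avg y (Suc m))"
        using convex_on_time_avg_le[OF concave[OF q, unfolded concave_on_def] mem(2) m]
        by (simp add: sum_negf)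
      show "(\<Sum>s=1..m. g s \<bullet> (x s - q)) / real m \<le> (sqrt (real m) * F\<^sub>1 q + real m * d\<^sub>1 q) / real m"
        using regret1[OF m q] by (rule divide_right_mono) simp
    qed
    finally show ?thesis using scale[OF m] by simp
  qed
  have lower: "f (time_avg x (Suc m)) q \<le> val m + F\<^sub>2 q / sqrt (real m) + d\<^sub>2 q"
    if m: "m \<ge> 1" and q: "q \<in> Y" for m q
  proof -
    have *: "f (x s) q \<le> f (x s) (y s) + h s \<bullet> (y s - q)" if "s \<in> {1..m}" for s
      using super[of s] that q by (auto simp: subgradient_on_def inner_diff_right algebra_simps)
    have "f (time_avg x (Suc m)) q \<le> (\<Sum>s=1..m. f (x s) q) / real m"
      by (rule convex_on_time_avg_le[OF convex[OF q] mem(1) m])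
    also have "\<dots> \<le> ((\<Sum>s=1..m. f (x s) (y s)) + (\<Sum>s=1..m. h s \<bullet> (y s - q))) / real m"
      unfolding sum.distrib[symmetric] using * by (intro divide_right_mono sum_mono) auto
    also have "\<dots> \<le> val m + (sqrt (real m) * F\<^sub>2 q + real m * d\<^sub>2 q) / real m"
      unfolding val_def add_divide_distrib[of "sum _ _"]
      using divide_right_mono[OF regret2[OF m q], of "real m"] by simp
    finally show ?thesis using scale[OF m] by simp
  qed
  have mono: "a \<le> a' \<Longrightarrow> a / sqrt (real m) \<le> a' / sqrt (real m)" for a a' :: real and m
    by (rule divide_right_mono) auto
  \<comment> \<open>Up to errors, the chain is: value at the averages, \<open>val n\<close>, value
    at (average of \<open>x\<close> up to \<open>r\<close>, average of \<open>y\<close> up to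
    \<open>n\<close>), \<open>val r\<close>, value at \<open>p\<close> and the average of
    \<open>y\<close> up to \<open>r\<close>, \<open>v\<close>. \<open>K\<close> collects the errors
    divided by \<open>sqrt r\<close>.\<close>
  define K where "K = k\<^sub>1 + c\<^sub>2 + F\<^sub>1 p"
  have bound: "f (time_avg x (Suc n)) (time_avg y (Suc n)) - v
      \<le> (c\<^sub>1 + c\<^sub>2 + 2 * k\<^sub>2) / sqrt (real n) + K / sqrt (real r)" if r: "r \<ge> 1" for r
  proof -
    have xr: "time_avg x (Suc r) \<in> X" and yn: "time_avg y (Suc n) \<in> Y" and yr: "time_avg y (Suc r) \<in> Y"
      using sets mem r n by (auto intro!: time_avg_mem)
    show ?thesis
      using lower[OF n yn] upper[OF n xr] lower[OF r yn] upper[OF r p(1)] p(2) p(3)[OF yr]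
        mono[OF F2[OF n], of n] mono[OF F2[OF n], of r] mono[OF F1[OF r], of n] d1[OF r] d2[OF n]
      by (simp add: K_def add_divide_distrib)
  qed
  have "(\<lambda>r. (c\<^sub>1 + c\<^sub>2 + 2 * k\<^sub>2) / sqrt (real n) + K / sqrt (real r))
      \<longlonglongrightarrow> (c\<^sub>1 + c\<^sub>2 + 2 * k\<^sub>2) / sqrt (real n) + 0"
    by (intro tendsto_add tendsto_const
        real_tendsto_divide_at_top[OF tendsto_const filterlim_compose[OF sqrt_at_top filterlim_real_sequentially]])
  then show ?thesis
    using bound by (intro LIMSEQ_le_const) auto
qed

section \<open>Players with a local and a networked variable\<close>

locale network_player = consensus_player P b c Y y h \<eta> R H
  for P :: "nat \<Rightarrow> real^'n^'n" and b c and Y :: "(real^'d) set" and y h \<eta> R H +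
  fixes X :: "(real^'e) set" and x g :: "nat \<Rightarrow> real^'e" and Rx Hx :: real
  assumes X: "closed X" "convex X"
    and x_mem: "\<And>t. t \<ge> 1 \<Longrightarrow> x t \<in> X"
    and x_step: "\<And>t. t \<ge> 1 \<Longrightarrow> x (Suc t) = closest_point X (x t - \<eta> t *\<^sub>R g t)"
    and Rx: "\<And>t. t \<ge> 1 \<Longrightarrow> norm (x t) \<le> Rx" and Hx: "\<And>t. t \<ge> 1 \<Longrightarrow> norm (g t) \<le> Hx"
begin

definition regret_factor :: "(real^'e) \<times> ((real^'d)^'n) \<Rightarrow> real" where
  "regret_factor p = doubling_const / 2 * ((Rx + norm (fst p))\<^sup>2 + Hx\<^sup>2)
    + (doubling_const / 2 * ((R + norm (snd p))\<^sup>2 + H\<^sup>2) + 2 * H * (doubling_const * gap))"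

definition regret_factor_bound :: real where
  "regret_factor_bound = doubling_const / 2 * (4 * (Rx\<^sup>2 + R\<^sup>2) + (Hx\<^sup>2 + H\<^sup>2))
    + 2 * H * (doubling_const * gap)"

lemma joint_regret:
  assumes n: "n \<ge> 1" and p: "p \<in> X \<times> copies Y"
  shows "(\<Sum>s=1..n. (g s, h s) \<bullet> ((x s, y s) - p))
    \<le> sqrt (real n) * regret_factor p + real n * (H * disagreement (snd p))"
proof -
  obtain px py where [simp]: "p = (px, py)" by (cases p)
  have "(\<Sum>s=1..n. g s \<bullet> (x s - px)) \<le> sqrt (real n) * (doubling_const / 2 * ((Rx + norm px)\<^sup>2 + Hx\<^sup>2))"
    by (rule doubling_regret[OF X _ \<eta> x_step _ Rx Hx n]) (use p in auto)
  moreover have "(\<Sum>s=1..n. (g s, h s) \<bullet> ((x s, y s) - p))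
      = (\<Sum>s=1..n. g s \<bullet> (x s - px)) + (\<Sum>s=1..n. h s \<bullet> (y s - py))"
    by (simp add: sum.distrib)
  ultimately show ?thesis
    using regret[OF n, of py] p by (simp add: regret_factor_def distrib_left)
qed

lemma time_avg_pair: "time_avg (\<lambda>s. (x s, y s)) n = (time_avg x n, time_avg y n)"
  by (simp add: time_avg_def prod_eq_iff fst_sum snd_sum)

lemma regret_factor_time_avg:
  assumes "n \<ge> 1"
  shows "regret_factor (time_avg (\<lambda>s. (x s, y s)) (Suc n)) \<le> regret_factor_bound"
proof -
  have "(r + norm v)\<^sup>2 \<le> 4 * r\<^sup>2" if "norm v \<le> r" for r and v :: "'z::real_normed_vector"
  proof -
    have "(r + norm v)\<^sup>2 \<le> (2 * r)\<^sup>2"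
      using that norm_ge_zero[of v] by (intro power_mono) linarith+
    then show ?thesis by simp
  qed
  then have "(Rx + norm (time_avg x (Suc n)))\<^sup>2 \<le> 4 * Rx\<^sup>2" "(R + norm (time_avg y (Suc n)))\<^sup>2 \<le> 4 * R\<^sup>2"
    using norm_time_avg_le[of x Rx n, OF Rx assms] norm_time_avg_le[of y R n, OF R assms] by auto
  then have "doubling_const / 2 * ((Rx + norm (time_avg x (Suc n)))\<^sup>2 + (R + norm (time_avg y (Suc n)))\<^sup>2)
      \<le> doubling_const / 2 * (4 * Rx\<^sup>2 + 4 * R\<^sup>2)"
    using doubling_const_pos by (intro mult_left_mono) auto
  then show ?thesis
    by (simp add: regret_factor_def regret_factor_bound_def time_avg_pair algebra_simps)
qed

text \<open>The added term is the surplus \<open>2 * k\<^sub>2\<close> of the saddle estimate. Up to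
  the factor \<open>doubling_const / 2\<close>, all disagreement terms amount to
  \<open>8 * H * gap = 3 * H * C * (R + H)\<close>, which the last summand of
  \<open>alpha_hat\<close> dominates.\<close>

lemma regret_factor_bound_le_alpha:
  assumes "0 \<le> \<sigma>" "0 \<le> \<Lambda>"
  shows "regret_factor_bound + 2 * (H * (doubling_const * gap)) \<le> alpha \<sigma> \<Lambda> (C_u c CARD('n) b) Rx R Hx H / 2"
    (is "?lhs \<le> alpha \<sigma> \<Lambda> ?C _ _ _ _ / 2")
proof -
  have C: "0 \<le> ?C"
    by (intro C_u_nonneg c c_le_1) (simp add: Suc_le_eq)
  have "8 * H * gap = H * (3 * (?C * (R + H)))"
    by (simp add: gap_def)
  also have "\<dots> \<le> H * ((3 + \<sigma> * \<Lambda>) * (?C * (R + 2 * H)))"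
    using assms C R_nonneg H_nonneg by (intro mult_left_mono mult_mono) auto
  finally have "4 * (Rx\<^sup>2 + R\<^sup>2) + (Hx\<^sup>2 + H\<^sup>2) + 8 * H * gap \<le> alpha_hat \<sigma> \<Lambda> ?C Rx R Hx H"
    unfolding alpha_hat_def mult.assoc by (intro add_mono) auto
  then have "doubling_const / 2 * (4 * (Rx\<^sup>2 + R\<^sup>2) + (Hx\<^sup>2 + H\<^sup>2) + 8 * H * gap)
      \<le> doubling_const / 2 * alpha_hat \<sigma> \<Lambda> ?C Rx R Hx H"
    using doubling_const_pos by (intro mult_left_mono) auto
  then show ?thesis
    by (simp add: regret_factor_bound_def alpha_def doubling_const_def[symmetric] algebra_simps)
qed

lemma disagreement_time_avg_pair:
  assumes "n \<ge> 1"
  shows "H * disagreement (snd (time_avg (\<lambda>s. (x s, y s)) (Suc n))) \<le> H * (doubling_const * gap) / sqrt (real n)"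
  using mult_left_mono[OF disagreement_average_le[OF assms] H_nonneg] by (simp add: time_avg_pair)

lemma disagreement_cost_nonneg: "0 \<le> H * (doubling_const * gap)"
  using H_nonneg gap_nonneg doubling_const_pos by simp

end

text \<open>An abstract \<open>f\<close> and two players of the same shape make the estimate
  reusable with the roles exchanged.\<close>

lemma network_saddle_average_upper:
  fixes P :: "nat \<Rightarrow> real^'n^'n" and f :: "(real^'e) \<times> ((real^'d)^'n) \<Rightarrow> (real^'f) \<times> ((real^'k)^'n) \<Rightarrow> real"
  assumes p1: "network_player P b c Y\<^sub>1 y\<^sub>1 h\<^sub>1 \<eta> R\<^sub>1 H\<^sub>1 X\<^sub>1 x\<^sub>1 g\<^sub>1 Rx\<^sub>1 Hx\<^sub>1"
    and p2: "network_player P b c Y\<^sub>2 y\<^sub>2 h\<^sub>2 \<eta> R\<^sub>2 H\<^sub>2 X\<^sub>2 x\<^sub>2 g\<^sub>2 Rx\<^sub>2 Hx\<^sub>2"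
    and convex: "\<And>u. u \<in> X\<^sub>2 \<times> copies Y\<^sub>2 \<Longrightarrow> convex_on (X\<^sub>1 \<times> copies Y\<^sub>1) (\<lambda>u'. f u' u)"
    and concave: "\<And>u. u \<in> X\<^sub>1 \<times> copies Y\<^sub>1 \<Longrightarrow> concave_on (X\<^sub>2 \<times> copies Y\<^sub>2) (\<lambda>u'. f u u')"
    and sub: "\<And>s. s \<ge> 1 \<Longrightarrow>
      subgradient_on (X\<^sub>1 \<times> copies Y\<^sub>1) (\<lambda>u. f u (x\<^sub>2 s, y\<^sub>2 s)) (x\<^sub>1 s, y\<^sub>1 s) (g\<^sub>1 s, h\<^sub>1 s)"
    and super: "\<And>s. s \<ge> 1 \<Longrightarrow>
      subgradient_on (X\<^sub>2 \<times> copies Y\<^sub>2) (\<lambda>u. - f (x\<^sub>1 s, y\<^sub>1 s) u) (x\<^sub>2 s, y\<^sub>2 s) (g\<^sub>2 s, h\<^sub>2 s)"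
    and p: "px \<in> X\<^sub>1" "py \<in> Y\<^sub>1" "\<And>u. u \<in> X\<^sub>2 \<times> copies Y\<^sub>2 \<Longrightarrow> f (px, \<chi> i. py) u \<le> v"
    and n: "n \<ge> 1" and pos: "0 \<le> \<sigma>" "0 \<le> \<Lambda>"
  shows "f (time_avg x\<^sub>1 (Suc n), time_avg y\<^sub>1 (Suc n)) (time_avg x\<^sub>2 (Suc n), time_avg y\<^sub>2 (Suc n)) - v
    \<le> (alpha \<sigma> \<Lambda> (C_u c CARD('n) b) Rx\<^sub>1 R\<^sub>1 Hx\<^sub>1 H\<^sub>1 + alpha \<sigma> \<Lambda> (C_u c CARD('n) b) Rx\<^sub>2 R\<^sub>2 Hx\<^sub>2 H\<^sub>2)
      / (2 * sqrt (real n))"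
proof -
  interpret p1: network_player P b c Y\<^sub>1 y\<^sub>1 h\<^sub>1 \<eta> R\<^sub>1 H\<^sub>1 X\<^sub>1 x\<^sub>1 g\<^sub>1 Rx\<^sub>1 Hx\<^sub>1 by (rule p1)
  interpret p2: network_player P b c Y\<^sub>2 y\<^sub>2 h\<^sub>2 \<eta> R\<^sub>2 H\<^sub>2 X\<^sub>2 x\<^sub>2 g\<^sub>2 Rx\<^sub>2 Hx\<^sub>2 by (rule p2)
  let ?k1 = "H\<^sub>1 * (doubling_const * p1.gap)" and ?k2 = "H\<^sub>2 * (doubling_const * p2.gap)"
  have "f (time_avg (\<lambda>s. (x\<^sub>1 s, y\<^sub>1 s)) (Suc n)) (time_avg (\<lambda>s. (x\<^sub>2 s, y\<^sub>2 s)) (Suc n)) - v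
      \<le> (p1.regret_factor_bound + p2.regret_factor_bound + 2 * ?k2) / sqrt (real n)"
  proof (rule saddle_average_upper[where X = "X\<^sub>1 \<times> copies Y\<^sub>1" and Y = "X\<^sub>2 \<times> copies Y\<^sub>2"
        and p = "(px, \<chi> i. py)" and f = f
        and x = "\<lambda>s. (x\<^sub>1 s, y\<^sub>1 s)" and y = "\<lambda>s. (x\<^sub>2 s, y\<^sub>2 s)"
        and g = "\<lambda>s. (g\<^sub>1 s, h\<^sub>1 s)" and h = "\<lambda>s. (g\<^sub>2 s, h\<^sub>2 s)"
        and F\<^sub>1 = p1.regret_factor and F\<^sub>2 = p2.regret_factor
        and d\<^sub>1 = "\<lambda>q. H\<^sub>1 * disagreement (snd q)" and d\<^sub>2 = "\<lambda>q. H\<^sub>2 * disagreement (snd q)"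
        and k\<^sub>1 = ?k1 and k\<^sub>2 = ?k2])
    show "convex (X\<^sub>1 \<times> copies Y\<^sub>1)" "convex (X\<^sub>2 \<times> copies Y\<^sub>2)"
      using p1.X p2.X p1.Y p2.Y by (auto intro!: convex_Times copies_convex)
    show "(px, \<chi> i. py) \<in> X\<^sub>1 \<times> copies Y\<^sub>1"
      using p by (simp add: copies_def)
    show "H\<^sub>1 * disagreement (snd (px, \<chi> i. py)) = 0"
      by (simp add: disagreement_def consensus_const)
  qed (use convex concave sub super p n p1.x_mem p1.mem p2.x_mem p2.mem
      p1.joint_regret p2.joint_regret p1.regret_factor_time_avg p2.regret_factor_time_avg
      p1.disagreement_time_avg_pair p2.disagreement_time_avg_pair in auto)
  also have "\<dots> \<le> (alpha \<sigma> \<Lambda> (C_u c CARD('n) b) Rx\<^sub>1 R\<^sub>1 Hx\<^sub>1 H\<^sub>1 / 2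
      + alpha \<sigma> \<Lambda> (C_u c CARD('n) b) Rx\<^sub>2 R\<^sub>2 Hx\<^sub>2 H\<^sub>2 / 2) / sqrt (real n)"
    using p1.regret_factor_bound_le_alpha[OF pos] p2.regret_factor_bound_le_alpha[OF pos]
      p1.disagreement_cost_nonneg by (intro divide_right_mono) auto
  finally show ?thesis
    by (simp add: p1.time_avg_pair p2.time_avg_pair add_divide_distrib)
qed

theorem mainTheorem1:
  fixes W :: "(real^'w) set" and \<D> :: "(real^'d) set" and M :: "(real^'m) set" and Z :: "(real^'z) set"
    and \<phi> :: "real^'w \<Rightarrow> (real^'d)^'n \<Rightarrow> real^'m \<Rightarrow> (real^'z)^'n \<Rightarrow> real"
    and A :: "nat \<Rightarrow> real^'n^'n"
    and B :: nat and \<delta> \<Lambda> d\<^sub>m\<^sub>a\<^sub>x \<delta>' \<delta>t \<sigma> :: real and \<eta> :: "nat \<Rightarrow> real"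
    and w gw :: "nat \<Rightarrow> real^'w" and D gD :: "nat \<Rightarrow> (real^'d)^'n"
    and \<mu> g\<mu> :: "nat \<Rightarrow> real^'m" and z gz :: "nat \<Rightarrow> (real^'z)^'n"
    and Bw BD B\<mu> Bz Hw HD H\<mu> Hz :: real
    and \<alpha>wD \<alpha>\<mu>z :: real
    and ws :: "real^'w" and Ds :: "real^'d" and \<mu>s :: "real^'m" and zs :: "real^'z"
  assumes sets: "closed W" "convex W" "closed \<D>" "convex \<D>" "closed M" "convex M" "closed Z" "convex Z"
    and convex: "\<forall>\<mu>'\<in>M. \<forall>z'\<in>copies Z. convex_on (W \<times> copies \<D>) (\<lambda>(w', D'). \<phi> w' D' \<mu>' z')"
    and concave: "\<forall>w'\<in>W. \<forall>D'\<in>copies \<D>. concave_on (M \<times> copies Z) (\<lambda>(\<mu>', z'). \<phi> w' D' \<mu>' z')"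
    and nonneg: "\<forall>t\<ge>1. \<forall>i j. 0 \<le> A t $ i $ j"
    and connected: "B \<ge> 1" "jointly_connected B A"
    and nondeg: "\<delta> > 0" "nondegenerate \<delta> A"
    and balanced: "\<forall>t\<ge>1. weight_balanced (A t)"
    and singular: "\<forall>t\<ge>1. sigma_max (laplacian (A t)) \<le> \<Lambda>"
    and dmax: "bdd_above {out_degree (A t) k | k t. t \<ge> 1}"
      "d\<^sub>m\<^sub>a\<^sub>x = Sup {out_degree (A t) k | k t. t \<ge> 1}"
    and delta: "0 < \<delta>'" "\<delta>' < 1" "\<delta>t = min \<delta>' ((1 - \<delta>') * (\<delta> / d\<^sub>m\<^sub>a\<^sub>x))"
    and stepsize: "\<sigma> \<in> {\<delta>t / \<delta>..(1 - \<delta>t) / d\<^sub>m\<^sub>a\<^sub>x}"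
    and dynamics: "saddle_dynamics W \<D> M Z \<phi> A \<sigma> \<eta> w D \<mu> z gw gD g\<mu> gz"
    and bounded_iterates: "(\<exists>c. \<forall>t\<ge>1. \<eta> t \<le> c) \<longrightarrow>
      (\<forall>t\<ge>1. norm (w t) \<le> Bw \<and> norm (D t) \<le> BD \<and> norm (\<mu> t) \<le> B\<mu> \<and> norm (z t) \<le> Bz)"
    and bounded_subgradients:
      "\<forall>t\<ge>1. norm (gw t) \<le> Hw \<and> norm (gD t) \<le> HD \<and> norm (g\<mu> t) \<le> H\<mu> \<and> norm (gz t) \<le> Hz"
    and rates: "doubling_trick \<eta>"
    and saddle: "Ds \<in> \<D>" "zs \<in> Z" "is_saddle_point W \<D> M Z \<phi> ws (\<chi> i. Ds) \<mu>s (\<chi> i. zs)"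
    and alpha_wD: "\<alpha>wD = alpha \<sigma> \<Lambda> (C_u \<delta>t CARD('n) B) Bw BD Hw HD"
    and alpha_\<mu>z: "\<alpha>\<mu>z = alpha \<sigma> \<Lambda> (C_u \<delta>t CARD('n) B) B\<mu> Bz H\<mu> Hz"
  shows "\<forall>t\<ge>2.
      - (\<alpha>\<mu>z + \<alpha>wD) / (2 * sqrt (real (t - 1)))
        \<le> \<phi> (time_avg w t) (time_avg D t) (time_avg \<mu> t) (time_avg z t) - \<phi> ws (\<chi> i. Ds) \<mu>s (\<chi> i. zs) \<and>
      \<phi> (time_avg w t) (time_avg D t) (time_avg \<mu> t) (time_avg z t) - \<phi> ws (\<chi> i. Ds) \<mu>s (\<chi> i. zs)
        \<le> (\<alpha>wD + \<alpha>\<mu>z) / (2 * sqrt (real (t - 1)))"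
proof -
  let ?P = "\<lambda>t. averaging_matrix \<sigma> (A t)"
  let ?f = "\<lambda>(w', D') (\<mu>', z'). \<phi> w' D' \<mu>' z'"
  have \<sigma>: "0 < \<sigma>"
    and init: "w 1 \<in> W" "D 1 \<in> copies \<D>" "\<mu> 1 \<in> M" "z 1 \<in> copies Z"
    and sub: "\<And>t. t \<ge> 1 \<Longrightarrow>
      subgradient_on (W \<times> copies \<D>) (\<lambda>(w', D'). \<phi> w' D' (\<mu> t) (z t)) (w t, D t) (gw t, gD t)"
    and super: "\<And>t. t \<ge> 1 \<Longrightarrow>
      subgradient_on (M \<times> copies Z) (\<lambda>u. - (\<lambda>(\<mu>', z'). \<phi> (w t) (D t) \<mu>' z') u) (\<mu> t, z t) (- (g\<mu> t, gz t))"
    and step: "\<And>t. t \<ge> 1 \<Longrightarrow> (w (t + 1), D (t + 1), \<mu> (t + 1), z (t + 1)) =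
          closest_point (saddle_domain W \<D> M Z)
            (w t - \<eta> t *\<^sub>R gw t,
             D t - \<sigma> *\<^sub>R kron_id_mult (laplacian (A t)) (D t) - \<eta> t *\<^sub>R gD t,
             \<mu> t + \<eta> t *\<^sub>R g\<mu> t,
             z t - \<sigma> *\<^sub>R kron_id_mult (laplacian (A t)) (z t) + \<eta> t *\<^sub>R gz t)"
    using dynamics unfolding saddle_dynamics_def concave_subgradient_on_def
    by (auto simp: saddle_domain_def)
  have mem: "w t \<in> W" "D t \<in> copies \<D>" "\<mu> t \<in> M" "z t \<in> copies Z" if "t \<ge> 1" for t
    using sub[OF that] super[OF that] by (auto simp: subgradient_on_def)
  have proj: "closest_point (saddle_domain W \<D> M Z) (a, b, c, d)
      = (closest_point W a, closest_point (copies \<D>) b, closest_point M c, closest_point (copies Z) d)"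
    for a and b :: "(real^'d)^'n" and c and d :: "(real^'z)^'n"
  proof -
    have "W \<noteq> {}" "copies \<D> \<noteq> ({} :: ((real^'d)^'n) set)" "M \<noteq> {}" "copies Z \<noteq> ({} :: ((real^'z)^'n) set)"
      using init by auto
    then show ?thesis
      using sets unfolding saddle_domain_def
      by (simp add: closest_point_Times closed_Times convex_Times copies_closed copies_convex)
  qed
  have step': "w (Suc t) = closest_point W (w t - \<eta> t *\<^sub>R gw t)"
      "D (Suc t) = closest_point (copies \<D>) (kron_id_mult (?P t) (D t) - \<eta> t *\<^sub>R gD t)"
      "\<mu> (Suc t) = closest_point M (\<mu> t - \<eta> t *\<^sub>R (- g\<mu> t))"
      "z (Suc t) = closest_point (copies Z) (kron_id_mult (?P t) (z t) - \<eta> t *\<^sub>R (- gz t))" if "t \<ge> 1" for t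
    using step[OF that] by (simp_all add: proj kron_id_mult_averaging_matrix)
  \<comment> \<open>The doubling rates are at most 1, which discharges the premise of
    \<open>bounded_iterates\<close>.\<close>
  have bounds: "norm (w t) \<le> Bw" "norm (D t) \<le> BD" "norm (\<mu> t) \<le> B\<mu>" "norm (z t) \<le> Bz" if "t \<ge> 1" for t
    using bounded_iterates doubling_trick_le_1[OF rates] that by blast+
  have degree: "out_degree (A t) i \<le> d\<^sub>m\<^sub>a\<^sub>x" if "t \<ge> 1" for t i
    unfolding dmax(2) using that by (intro cSup_upper dmax(1)) blast
  have "0 \<le> out_degree (A 1) undefined"
    unfolding out_degree_def using nonneg by (intro sum_nonneg) auto
  then have "0 \<le> d\<^sub>m\<^sub>a\<^sub>x"
    using degree[of 1 undefined] by simp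
  \<comment> \<open>Division by zero yields 0, so a vanishing maximal degree would force
    \<open>\<sigma> <= 0\<close>.\<close>
  moreover have "d\<^sub>m\<^sub>a\<^sub>x \<noteq> 0"
    using stepsize \<sigma> by auto
  ultimately have d: "0 < d\<^sub>m\<^sub>a\<^sub>x" by simp
  have \<delta>t: "0 < \<delta>t"
    using delta nondeg(1) d by simp
  have "averaging_network ?P B \<delta>t"
  proof (rule averaging_network_of_digraphs[OF nonneg connected nondeg(2) balanced \<sigma> \<delta>t])
    show "\<delta>t \<le> \<sigma> * \<delta>"
      using stepsize nondeg(1) by (simp add: pos_divide_le_eq)
    show "\<sigma> * out_degree (A t) i \<le> 1 - \<delta>t" if "t \<ge> 1" for t i
    proof -
      have "\<sigma> * out_degree (A t) i \<le> \<sigma> * d\<^sub>m\<^sub>a\<^sub>x"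
        using degree[OF that] \<sigma> by simp
      also have "\<dots> \<le> 1 - \<delta>t"
        using stepsize d by (simp add: pos_le_divide_eq)
      finally show ?thesis .
    qed
  qed
  then interpret averaging_network ?P B \<delta>t .
  have H: "norm (gw t) \<le> Hw" "norm (gD t) \<le> HD" "norm (- g\<mu> t) \<le> H\<mu>" "norm (- gz t) \<le> Hz" if "t \<ge> 1" for t
    using bounded_subgradients that by auto
  have p1: "network_player ?P B \<delta>t \<D> D gD \<eta> BD HD W w gw Bw Hw"
    by unfold_locales (fact sets rates mem step' bounds H)+
  \<comment> \<open>The concave player ascends; negated supergradients bring its step into the
    descent form of the locale.\<close>
  have p2: "network_player ?P B \<delta>t Z z (\<lambda>t. - gz t) \<eta> Bz Hz M \<mu> (\<lambda>t. - g\<mu> t) B\<mu> H\<mu>"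
    by unfold_locales (fact sets rates mem step' bounds H)+
  have \<Lambda>: "0 \<le> \<Lambda>"
    using singular sigma_max_laplacian_nonneg[of "A 1"] by (meson order_refl order_trans)
  let ?v = "\<phi> ws (\<chi> i. Ds) \<mu>s (\<chi> i. zs)"
  have star: "ws \<in> W" "\<mu>s \<in> M"
      "((\<chi> i. Ds) :: (real^'d)^'n) \<in> copies \<D>" "((\<chi> i. zs) :: (real^'z)^'n) \<in> copies Z"
    and opt: "\<And>w' D' \<mu>' z'. w' \<in> W \<Longrightarrow> D' \<in> copies \<D> \<Longrightarrow> \<mu>' \<in> M \<Longrightarrow> z' \<in> copies Z \<Longrightarrow>
      \<phi> ws (\<chi> i. Ds) \<mu>' z' \<le> ?v \<and> ?v \<le> \<phi> w' D' \<mu>s (\<chi> i. zs)"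
    using saddle(3) unfolding is_saddle_point_def saddle_domain_def by auto
  have sub': "subgradient_on (W \<times> copies \<D>) (\<lambda>u. ?f u (\<mu> t, z t)) (w t, D t) (gw t, gD t)"
    and super': "subgradient_on (M \<times> copies Z) (\<lambda>u. - ?f (w t, D t) u) (\<mu> t, z t) (- g\<mu> t, - gz t)"
    if "t \<ge> 1" for t
    using sub[OF that] super[OF that] by (auto simp: subgradient_on_def)
  show ?thesis
  proof (intro allI impI)
    fix t :: nat assume t: "t \<ge> 2"
    then obtain n where n: "t = Suc n" "n \<ge> 1"
      by (cases t) auto
    have "?f (time_avg w (Suc n), time_avg D (Suc n)) (time_avg \<mu> (Suc n), time_avg z (Suc n)) - ?v
        \<le> (\<alpha>wD + \<alpha>\<mu>z) / (2 * sqrt (real n))"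
      unfolding alpha_wD alpha_\<mu>z
    proof (rule network_saddle_average_upper[OF p1 p2 _ _ sub' super' star(1) saddle(1) _ n(2) less_imp_le[OF \<sigma>] \<Lambda>])
      show "convex_on (W \<times> copies \<D>) (\<lambda>u'. ?f u' u)" if "u \<in> M \<times> copies Z" for u
        using convex that by (auto simp: case_prod_unfold)
      show "concave_on (M \<times> copies Z) (\<lambda>u'. ?f u u')" if "u \<in> W \<times> copies \<D>" for u
        using concave that by (auto simp: case_prod_unfold)
      show "?f (ws, \<chi> i. Ds) u \<le> ?v" if "u \<in> M \<times> copies Z" for u
        using opt[OF star(1,3)] that by auto
    qed
    \<comment> \<open>The lower bound is the upper bound for the game with players exchanged and
      payoff negated. The two constants enter symmetrically after the slack in \<open>alpha\<close>
      has absorbed the surplus of whichever player comes second.\<close>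
    moreover have "- ?f (time_avg w (Suc n), time_avg D (Suc n)) (time_avg \<mu> (Suc n), time_avg z (Suc n)) - (- ?v)
        \<le> (\<alpha>\<mu>z + \<alpha>wD) / (2 * sqrt (real n))"
      unfolding alpha_wD alpha_\<mu>z
    proof (rule network_saddle_average_upper[where f = "\<lambda>u u'. - ?f u' u",
          OF p2 p1 _ _ super' _ star(2) saddle(2) _ n(2) less_imp_le[OF \<sigma>] \<Lambda>])
      show "convex_on (M \<times> copies Z) (\<lambda>u'. - ?f u u')" if "u \<in> W \<times> copies \<D>" for u
        using concave that by (auto simp: concave_on_def case_prod_unfold)
      show "concave_on (W \<times> copies \<D>) (\<lambda>u'. - ?f u' u)" if "u \<in> M \<times> copies Z" for u
        using convex that by (auto simp: concave_on_def case_prod_unfold)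
      show "subgradient_on (W \<times> copies \<D>) (\<lambda>u. - (- ?f u (\<mu> s, z s))) (w s, D s) (gw s, gD s)" if "s \<ge> 1" for s
        using sub'[OF that] by simp
      show "- ?f u (\<mu>s, \<chi> i. zs) \<le> - ?v" if "u \<in> W \<times> copies \<D>" for u
        using opt[OF _ _ star(2,4)] that by auto
    qed
    ultimately show "- (\<alpha>\<mu>z + \<alpha>wD) / (2 * sqrt (real (t - 1)))
          \<le> \<phi> (time_avg w t) (time_avg D t) (time_avg \<mu> t) (time_avg z t) - ?v \<and>
        \<phi> (time_avg w t) (time_avg D t) (time_avg \<mu> t) (time_avg z t) - ?v
          \<le> (\<alpha>wD + \<alpha>\<mu>z) / (2 * sqrt (real (t - 1)))"
      unfolding n(1) diff_Suc_1 prod.case minus_divide_left[symmetric] by linarith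
  qed
qed

end
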